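(* For any $A,B\in\mathcal B^{+*}(H)$ and $v\in[0,1]$ we have $$L_v(A,B)\leq L\big(A\sharp_v B,A\nabla_v B\big)\leq I\big(A\sharp_v B,A\nabla_v B\big)\leq\big(A\sharp_v B\big)\nabla\big(A\nabla_v B\big)$$ and $$A\sharp_v B\leq\big(A\nabla_v(A\sharp B)\big)\sharp_v\big((A\sharp B)\nabla_v B\big)\leq I_v(A,B).$$
   Context: $H$ is a complex Hilbert space, $\mathcal B(H)$ the $C^*$-algebra of bounded linear operators on $H$, and $\mathcal B^{+*}(H)$ the open cone of all (self-adjoint) positive invertible operators in $\mathcal B(H)$. For self-adjoint $A,B\in\mathcal B(H)$, $A\le B$ means that $B-A$ is positive semi-definite. For $A,B\in\mathcal B^{+*}(H)$ and $v\in[0,1]$: $$A\nabla_v B=(1-v)A+vB,\qquad A\sharp_v B=A^{1/2}\big(A^{-1/2}BA^{-1/2}\big)^vA^{1/2},$$ and for $v=1/2$ one writes $A\nabla B$ and $A\sharp B$. Scalar weighted logarithmic and identric means: for $a\neq b$ in $(0,\infty)$ and $v\in(0,1)$, with $a\nabla_v b=(1-v)a+vb$, $$L_v(a,b)=\frac{1}{\log a-\log b}\left(\frac{1-v}{v}\big(a-a^{1-v}b^v\big)+\frac{v}{1-v}\big(a^{1-v}b^v-b\big)\right),$$ $$I_v(a,b)=\frac1e\,\big(a\nabla_v b\big)^{\frac{(1-2v)(a\nabla_v b)}{v(1-v)(b-a)}}\left(\frac{b^{\frac{vb}{1-v}}}{a^{\frac{(1-v)a}{v}}}\right)^{\frac1{b-a}},$$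 with the limit values $L_0(a,b)=I_0(a,b)=a$, $L_1(a,b)=I_1(a,b)=b$, and $L_v(a,a)=I_v(a,a)=a$. The weighted logarithmic and identric means of operators $A,B\in\mathcal B^{+*}(H)$ are defined by continuous functional calculus: $$L_v(A,B)=A^{1/2}F_{L_v}\big(A^{-1/2}BA^{-1/2}\big)A^{1/2},\quad F_{L_v}(x)=L_v(1,x),$$ $$I_v(A,B)=A^{1/2}F_{I_v}\big(A^{-1/2}BA^{-1/2}\big)A^{1/2},\quad F_{I_v}(x)=I_v(1,x),$$ for $x>0$. For $v=1/2$ they are denoted $L(A,B):=L_{1/2}(A,B)$ and $I(A,B):=I_{1/2}(A,B)$. *)

theory Defs
  imports "HOL-Analysis.Analysis"
begin

section \<open>Complex Hilbert spaces\<close>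

text \<open>The inner product is conjugate-linear in the first and linear in the second argument.\<close>

class chilbert = banach +
  fixes scaleC :: "complex \<Rightarrow> 'a \<Rightarrow> 'a" (infixr "*\<^sub>C" 75)
    and cinner :: "'a \<Rightarrow> 'a \<Rightarrow> complex"
  assumes scaleC_add_right: "c *\<^sub>C (x + y) = c *\<^sub>C x + c *\<^sub>C y"
    and scaleC_add_left: "(c + d) *\<^sub>C x = c *\<^sub>C x + d *\<^sub>C x"
    and scaleC_scaleC: "c *\<^sub>C d *\<^sub>C x = (c * d) *\<^sub>C x"
    and scaleC_one: "1 *\<^sub>C x = x"
    and scaleR_scaleC: "r *\<^sub>R x = complex_of_real r *\<^sub>C x"
    and cinner_commute: "cinner x y = cnj (cinner y x)"
    and cinner_add_right: "cinner x (y + z) = cinner x y + cinner x z"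
    and cinner_scaleC_right: "cinner x (c *\<^sub>C y) = c * cinner x y"
    and cinner_nonneg: "cinner x x \<in> \<real>\<^sub>\<ge>\<^sub>0"
    and cinner_eq_zero_iff: "cinner x x = 0 \<longleftrightarrow> x = 0"
    and norm_eq_sqrt_cinner: "norm x = sqrt (Re (cinner x x))"

lemma cinner_scaleC_left: "cinner (c *\<^sub>C x) y = cnj c * cinner x y"
  for x y :: "'a::chilbert"
  by (metis cinner_commute cinner_scaleC_right complex_cnj_mult)

lemma norm_scaleC: "norm (c *\<^sub>C x) = cmod c * norm x" for x :: "'a::chilbert"
proof -
  have "cinner (c *\<^sub>C x) (c *\<^sub>C x) = complex_of_real ((cmod c)\<^sup>2) * cinner x x"
    by (simp add: cinner_scaleC_left cinner_scaleC_right complex_norm_square mult.assoc mult.left_commute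
        flip: of_real_power)
  then have "Re (cinner (c *\<^sub>C x) (c *\<^sub>C x)) = (cmod c)\<^sup>2 * Re (cinner x x)"
    by simp
  then show ?thesis
    by (simp add: norm_eq_sqrt_cinner real_sqrt_mult)
qed

section \<open>Bounded complex-linear operators\<close>

text \<open>\<open>'a \<Rightarrow>\<^sub>L 'a\<close> is the space of bounded \<^emph>\<open>real\<close>-linear operators;
  the algebra of bounded operators on the complex space is cut out by complex homogeneity.\<close>

definition bounded_ops :: "('a::chilbert \<Rightarrow>\<^sub>L 'a) set" where
  "bounded_ops = {T. \<forall>c x. blinfun_apply T (c *\<^sub>C x) = c *\<^sub>C blinfun_apply T x}"

lift_definition scalar_op :: "complex \<Rightarrow> ('a::chilbert \<Rightarrow>\<^sub>L 'a)" is "\<lambda>c x. c *\<^sub>C x"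
proof -
  fix c :: complex
  show "bounded_linear (\<lambda>x::'a. c *\<^sub>C x)"
    by (rule bounded_linear_intro[where K = "cmod c"])
      (simp_all add: scaleC_add_right scaleR_scaleC scaleC_scaleC norm_scaleC mult.commute)
qed

definition invertible_op :: "('a::chilbert \<Rightarrow>\<^sub>L 'a) \<Rightarrow> bool" where
  "invertible_op T \<longleftrightarrow>
    (\<exists>S\<in>bounded_ops. S o\<^sub>L T = id_blinfun \<and> T o\<^sub>L S = id_blinfun)"

definition is_adjoint :: "('a::chilbert \<Rightarrow>\<^sub>L 'a) \<Rightarrow> ('a \<Rightarrow>\<^sub>L 'a) \<Rightarrow> bool" where
  "is_adjoint S T \<longleftrightarrow>
    (\<forall>x y. cinner (blinfun_apply S x) y = cinner x (blinfun_apply T y))"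

definition selfadjoint_op :: "('a::chilbert \<Rightarrow>\<^sub>L 'a) \<Rightarrow> bool" where
  "selfadjoint_op T \<longleftrightarrow> T \<in> bounded_ops \<and> is_adjoint T T"

definition psd_op :: "('a::chilbert \<Rightarrow>\<^sub>L 'a) \<Rightarrow> bool" where
  "psd_op T \<longleftrightarrow>
    selfadjoint_op T \<and> (\<forall>x. cinner x (blinfun_apply T x) \<in> \<real>\<^sub>\<ge>\<^sub>0)"

definition positive_invertible_ops :: "('a::chilbert \<Rightarrow>\<^sub>L 'a) set" where
  "positive_invertible_ops = {T. psd_op T \<and> invertible_op T}"

definition loewner_le :: "('a::chilbert \<Rightarrow>\<^sub>L 'a) \<Rightarrow> ('a \<Rightarrow>\<^sub>L 'a) \<Rightarrow> bool"
    (infix "\<preceq>" 50) where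
  "A \<preceq> B \<longleftrightarrow> selfadjoint_op A \<and> selfadjoint_op B \<and> psd_op (B - A)"

section \<open>Continuous functional calculus\<close>

definition op_spectrum :: "('a::chilbert \<Rightarrow>\<^sub>L 'a) \<Rightarrow> complex set" where
  "op_spectrum T = {z. \<not> invertible_op (T - scalar_op z)}"

text \<open>\<open>\<Phi>\<close> is a unital *-homomorphism from the algebra of continuous complex functions on the
  spectrum of \<open>T\<close> to the bounded operators, mapping the identity function to \<open>T\<close>. A continuous
  function on the spectrum is represented by any of its extensions to the complex plane, hence the
  congruence condition; complex homogeneity is contained in multiplicativity and the condition on
  constants. For normal \<open>T\<close> this determines \<open>\<Phi>\<close> on continuous functions, so that the
  description in the next definition is proper for self-adjoint \<open>T\<close>.\<close>

definition functional_calculus ::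
    "('a::chilbert \<Rightarrow>\<^sub>L 'a) \<Rightarrow> ((complex \<Rightarrow> complex) \<Rightarrow> ('a \<Rightarrow>\<^sub>L 'a)) \<Rightarrow> bool" where
  "functional_calculus T \<Phi> \<longleftrightarrow>
    (\<forall>f g. continuous_on (op_spectrum T) f \<longrightarrow> continuous_on (op_spectrum T) g \<longrightarrow>
      \<Phi> f \<in> bounded_ops \<and>
      ((\<forall>z\<in>op_spectrum T. f z = g z) \<longrightarrow> \<Phi> f = \<Phi> g) \<and>
      \<Phi> (\<lambda>z. f z + g z) = \<Phi> f + \<Phi> g \<and>
      \<Phi> (\<lambda>z. f z * g z) = \<Phi> f o\<^sub>L \<Phi> g \<and>
      is_adjoint (\<Phi> (\<lambda>z. cnj (f z))) (\<Phi> f)) \<and>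
    (\<forall>c. \<Phi> (\<lambda>z. c) = scalar_op c) \<and>
    \<Phi> (\<lambda>z. z) = T"

text \<open>Meant for self-adjoint \<open>T\<close>, whose spectrum is real, and \<open>f\<close> continuous on the spectrum.\<close>

definition cfc :: "(real \<Rightarrow> real) \<Rightarrow> ('a::chilbert \<Rightarrow>\<^sub>L 'a) \<Rightarrow> ('a \<Rightarrow>\<^sub>L 'a)" where
  "cfc f T = (THE S. \<exists>\<Phi>. functional_calculus T \<Phi> \<and> S = \<Phi> (\<lambda>z. complex_of_real (f (Re z))))"

definition op_powr :: "('a::chilbert \<Rightarrow>\<^sub>L 'a) \<Rightarrow> real \<Rightarrow> ('a \<Rightarrow>\<^sub>L 'a)" where
  "op_powr T p = cfc (\<lambda>x. x powr p) T"

section \<open>Scalar means\<close>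

definition wamean :: "real \<Rightarrow> real \<Rightarrow> real \<Rightarrow> real" where
  "wamean v a b = (1 - v) * a + v * b"

definition wlogmean :: "real \<Rightarrow> real \<Rightarrow> real \<Rightarrow> real" where
  "wlogmean v a b =
    (if v = 0 then a else if v = 1 then b else if a = b then a
     else 1 / (ln a - ln b) *
       ((1 - v) / v * (a - a powr (1 - v) * b powr v)
        + v / (1 - v) * (a powr (1 - v) * b powr v - b)))"

definition widentric :: "real \<Rightarrow> real \<Rightarrow> real \<Rightarrow> real" where
  "widentric v a b =
    (if v = 0 then a else if v = 1 then b else if a = b then a
     else 1 / exp 1
       * wamean v a b powr (((1 - 2 * v) * wamean v a b) / (v * (1 - v) * (b - a)))
       * (b powr (v * b / (1 - v)) / a powr ((1 - v) * a / v)) powr (1 / (b - a)))"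

section \<open>Operator means\<close>

definition op_amean :: "real \<Rightarrow> ('a::chilbert \<Rightarrow>\<^sub>L 'a) \<Rightarrow> ('a \<Rightarrow>\<^sub>L 'a) \<Rightarrow> ('a \<Rightarrow>\<^sub>L 'a)" where
  "op_amean v A B = (1 - v) *\<^sub>R A + v *\<^sub>R B"

definition op_mean ::
    "(real \<Rightarrow> real) \<Rightarrow> ('a::chilbert \<Rightarrow>\<^sub>L 'a) \<Rightarrow> ('a \<Rightarrow>\<^sub>L 'a) \<Rightarrow> ('a \<Rightarrow>\<^sub>L 'a)" where
  "op_mean F A B =
    op_powr A (1/2) o\<^sub>L cfc F (op_powr A (-1/2) o\<^sub>L B o\<^sub>L op_powr A (-1/2)) o\<^sub>L op_powr A (1/2)"

definition op_gmean :: "real \<Rightarrow> ('a::chilbert \<Rightarrow>\<^sub>L 'a) \<Rightarrow> ('a \<Rightarrow>\<^sub>L 'a) \<Rightarrow> ('a \<Rightarrow>\<^sub>L 'a)" where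
  "op_gmean v A B = op_mean (\<lambda>x. x powr v) A B"

definition op_logmean :: "real \<Rightarrow> ('a::chilbert \<Rightarrow>\<^sub>L 'a) \<Rightarrow> ('a \<Rightarrow>\<^sub>L 'a) \<Rightarrow> ('a \<Rightarrow>\<^sub>L 'a)" where
  "op_logmean v A B = op_mean (\<lambda>x. wlogmean v 1 x) A B"

definition op_identric :: "real \<Rightarrow> ('a::chilbert \<Rightarrow>\<^sub>L 'a) \<Rightarrow> ('a \<Rightarrow>\<^sub>L 'a) \<Rightarrow> ('a \<Rightarrow>\<^sub>L 'a)" where
  "op_identric v A B = op_mean (\<lambda>x. widentric v 1 x) A B"

end

(* The functional calculus of a self-adjoint T is the limit of the polynomial calculus: if |p| <= M on
   the spectrum of T, then the spectrum of M^2 - p(T)^* p(T) is nonnegative by the fundamental theorem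
   of algebra, so that |p(T)| <= M, and the Stone-Weierstrass theorem extends p |-> p(T) to all
   continuous functions on the spectrum.

   Put C = A^(1/2), T = A^(-1/2) B A^(-1/2) and K f = C f(T) C. Then A = K 1 and B = K id, and since
   operator means commute with congruences, every mean of K f and K g is K of the pointwise scalar
   mean of f and g. As K is monotone, only scalar inequalities for the means of 1 and x remain. With the
   unweighted means L and I, g = x^v and m = 1 - v + v x,
     L_v(1,x) = (1-v) L(1,g) + v L(g,x),    I_v(1,x) = I(1,m)^(1-v) I(m,x)^v.
   The first inequality is the joint concavity of L, and L <= I <= arithmetic mean follow from
   L(1,r) = int_0^1 r^t dt, 1/L(1,r) = int_0^1 dt/(1-t+tr), log I(1,r) = int_0^1 log(1-t+tr) dt and the
   tangent lines of log. For y = sqrt x the refined geometric mean is y^v (1-v+vy), which lies between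
   x^v and sqrt(x^v m) <= I_v(1,x), using sqrt(ab) <= I(a,b). *)

theory Submission
  imports Defs "HOL-Computational_Algebra.Fundamental_Theorem_Algebra"
begin

section \<open>Hilbert space and bounded operators\<close>

text \<open>As \<open>cfc\<close> is a definite description, nothing can be said about it before the
  calculus is known to exist and to be unique. A competing calculus is only a star homomorphism, so
  its continuity has to be derived and is not part of the definition. Operator square roots become
  available only after that. The earlier norm estimates therefore rest on quadratic forms: a
  self-adjoint operator with form bounded below by a positive constant is invertible, and
  invertibility of all S - r with r < m forces the form of S to be at least m. On the operator side
  the obstacle is that the geometric and arithmetic means of A and B need not commute, so scalar
  inequalities do not apply to them directly; under K both become functions of the one operator T.
  The two weighted decompositions come from cutting a path at its weighted point: the curve t
  \<mapsto> x^t at t = v for the logarithmic mean, the straight segment from 1 to x at m for the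
  identric mean.\<close>

lemma cinner_add_left: "cinner (x + y) z = cinner x z + cinner y z"
  for x y z :: "'a::chilbert"
  by (metis cinner_commute cinner_add_right complex_cnj_add)

lemma cinner_scaleR_right: "cinner x (r *\<^sub>R y) = r *\<^sub>R cinner x y"
  for x y :: "'a::chilbert"
  by (simp add: scaleR_scaleC cinner_scaleC_right scaleR_conv_of_real)

lemma cinner_scaleR_left: "cinner (r *\<^sub>R x) y = r *\<^sub>R cinner x y"
  for x y :: "'a::chilbert"
  by (simp add: scaleR_scaleC cinner_scaleC_left scaleR_conv_of_real)

lemma cinner_self: "cinner x x = complex_of_real ((norm x)\<^sup>2)"
  for x :: "'a::chilbert"
  using cinner_nonneg[of x]
  by (simp add: complex_eq_iff norm_eq_sqrt_cinner complex_nonneg_Reals_iff del: of_real_power)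

lemma Re_cinner_commute: "Re (cinner x y) = Re (cinner y x)"
  for x y :: "'a::chilbert"
  by (metis cinner_commute complex_cnj(1) complex.sel(1) complex_cnj complex.collapse)

lemma norm_add_scaleR_sq:
  "(norm (x + t *\<^sub>R y))\<^sup>2 = (norm x)\<^sup>2 + 2 * t * Re (cinner x y) + t\<^sup>2 * (norm y)\<^sup>2"
  for x y :: "'a::chilbert"
proof -
  have "complex_of_real ((norm (x + t *\<^sub>R y))\<^sup>2) = cinner (x + t *\<^sub>R y) (x + t *\<^sub>R y)"
    by (simp only: cinner_self)
  also have "\<dots> = cinner x x + t *\<^sub>R cinner x y + t *\<^sub>R cinner y x + (t * t) *\<^sub>R cinner y y"
    by (simp add: cinner_add_left cinner_add_right cinner_scaleR_left cinner_scaleR_right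
        scaleR_add_right)
  finally have "(norm (x + t *\<^sub>R y))\<^sup>2
      = Re (cinner x x + t *\<^sub>R cinner x y + t *\<^sub>R cinner y x + (t * t) *\<^sub>R cinner y y)"
    by (metis Re_complex_of_real)
  then show ?thesis
    using Re_cinner_commute[of y x] by (simp add: cinner_self power2_eq_square)
qed

lemma Re_cinner_le: "\<bar>Re (cinner x y)\<bar> \<le> norm x * norm y"
  for x y :: "'a::chilbert"
proof (cases "y = 0")
  case True
  then show ?thesis
    using cinner_scaleR_right[of x 0 y] by simp
next
  case False
  define c where "c = Re (cinner x y)"
  have n: "norm y > 0" using False by simp
  \<comment> \<open>\<open>- c / (norm y)\<^sup>2\<close> is the minimiser of the quadratic t
    \<mapsto> |x + t y|^2.\<close>
  have "0 \<le> (norm x)\<^sup>2 + 2 * (- c / (norm y)\<^sup>2) * c + (- c / (norm y)\<^sup>2)\<^sup>2 * (norm y)\<^sup>2"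
    using norm_add_scaleR_sq[of x "- c / (norm y)\<^sup>2" y] unfolding c_def by (metis zero_le_power2)
  also have "\<dots> = (norm x)\<^sup>2 - c\<^sup>2 / (norm y)\<^sup>2"
    using n by (simp add: field_simps power2_eq_square)
  finally have "c\<^sup>2 \<le> (norm x * norm y)\<^sup>2"
    using n by (simp add: field_simps power_mult_distrib)
  then show ?thesis
    unfolding c_def by (simp add: abs_le_square_iff[symmetric])
qed

text \<open>The imaginary part of the inner product is its real part against -\<i> y, so the real
  Cauchy-Schwarz inequality controls both parts. The crude constant 2 is enough, as only zero,
  difference and limit rules are drawn from the interpretation.\<close>

lemma bounded_bilinear_cinner: "bounded_bilinear (cinner :: 'a::chilbert \<Rightarrow> 'a \<Rightarrow> complex)"
proof
  have "norm (cinner a b) \<le> norm a * norm b * 2" for a b :: 'a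
  proof -
    have "Im (cinner a b) = Re (cinner a ((-\<i>) *\<^sub>C b))"
      by (simp add: cinner_scaleC_right)
    then have "\<bar>Im (cinner a b)\<bar> \<le> norm a * norm b"
      using Re_cinner_le[of a "(-\<i>) *\<^sub>C b"] by (simp add: norm_scaleC)
    then show ?thesis
      using Re_cinner_le[of a b] cmod_le[of "cinner a b"] by linarith
  qed
  then show "\<exists>K. \<forall>a b :: 'a. norm (cinner a b) \<le> norm a * norm b * K" by blast
qed (simp_all add: cinner_add_left cinner_add_right cinner_scaleR_left cinner_scaleR_right)

interpretation cinner: bounded_bilinear "cinner :: 'a::chilbert \<Rightarrow> 'a \<Rightarrow> complex"
  by (rule bounded_bilinear_cinner)

lemma scaleC_right_diff: "c *\<^sub>C (x - y) = c *\<^sub>C x - c *\<^sub>C y" for x y :: "'a::chilbert"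
  by (metis add_diff_cancel_right' diff_add_cancel scaleC_add_right)

section \<open>The algebra of complex-linear bounded operators\<close>

lemma bounded_opsD: "T \<in> bounded_ops \<Longrightarrow> blinfun_apply T (c *\<^sub>C x) = c *\<^sub>C blinfun_apply T x"
  by (simp add: bounded_ops_def)

lemma bounded_ops_zero [simp]: "0 \<in> bounded_ops"
  by (simp add: bounded_ops_def) (metis add_cancel_right_right scaleC_add_right)

lemma bounded_ops_id [simp]: "id_blinfun \<in> bounded_ops"
  by (simp add: bounded_ops_def)

lemma bounded_ops_scalar_op [simp]: "scalar_op c \<in> bounded_ops"
  by (simp add: bounded_ops_def scalar_op.rep_eq scaleC_scaleC mult.commute)

lemma bounded_ops_add [intro]: "S \<in> bounded_ops \<Longrightarrow> T \<in> bounded_ops \<Longrightarrow> S + T \<in> bounded_ops"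
  by (simp add: bounded_ops_def blinfun.add_left scaleC_add_right)

lemma bounded_ops_diff [intro]: "S \<in> bounded_ops \<Longrightarrow> T \<in> bounded_ops \<Longrightarrow> S - T \<in> bounded_ops"
  by (simp add: bounded_ops_def blinfun.diff_left scaleC_right_diff)

lemma bounded_ops_compose [intro]: "S \<in> bounded_ops \<Longrightarrow> T \<in> bounded_ops \<Longrightarrow> S o\<^sub>L T \<in> bounded_ops"
  by (simp add: bounded_ops_def)

lemma bounded_ops_scaleR [intro]: "S \<in> bounded_ops \<Longrightarrow> r *\<^sub>R S \<in> bounded_ops"
  by (simp add: bounded_ops_def blinfun.scaleR_left scaleR_scaleC scaleC_scaleC mult.commute)

text \<open>Multiplication by \<open>c\<close> is itself the bounded operator
  \<open>scalar_op c\<close>, so it passes through limits; complex homogeneity is therefore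
  preserved.\<close>

lemma bounded_ops_tendsto:
  assumes "\<And>n. X n \<in> bounded_ops" and "X \<longlonglongrightarrow> S"
  shows "S \<in> bounded_ops"
proof -
  have "blinfun_apply S (c *\<^sub>C x) = c *\<^sub>C blinfun_apply S x" for c x
  proof (rule LIMSEQ_unique)
    show "(\<lambda>n. blinfun_apply (X n) (c *\<^sub>C x)) \<longlonglongrightarrow> blinfun_apply S (c *\<^sub>C x)"
      by (intro tendsto_intros assms)
    have "(\<lambda>n. scalar_op c (blinfun_apply (X n) x)) \<longlonglongrightarrow> scalar_op c (blinfun_apply S x)"
      by (intro tendsto_intros assms)
    then show "(\<lambda>n. blinfun_apply (X n) (c *\<^sub>C x)) \<longlonglongrightarrow> c *\<^sub>C blinfun_apply S x"
      using assms(1) by (simp add: bounded_opsD scalar_op.rep_eq)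
  qed
  then show ?thesis by (simp add: bounded_ops_def)
qed

lemma scalar_op_of_real: "scalar_op (complex_of_real r) = r *\<^sub>R id_blinfun"
  by (rule blinfun_eqI) (simp add: scalar_op.rep_eq blinfun.scaleR_left scaleR_scaleC)

lemma scalar_op_0 [simp]: "scalar_op 0 = 0"
  using scalar_op_of_real[of 0] by simp

lemma scalar_op_1: "scalar_op 1 = id_blinfun"
  using scalar_op_of_real[of 1] by simp

lemma scalar_op_add: "scalar_op (c + d) = scalar_op c + scalar_op d"
  by (rule blinfun_eqI) (simp add: scalar_op.rep_eq blinfun.add_left scaleC_add_left)

lemma scalar_op_mult: "scalar_op (c * d) = scalar_op c o\<^sub>L scalar_op d"
  by (rule blinfun_eqI) (simp add: scalar_op.rep_eq scaleC_scaleC)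

lemma scalar_op_commute: "T \<in> bounded_ops \<Longrightarrow> T o\<^sub>L scalar_op c = scalar_op c o\<^sub>L T"
  by (rule blinfun_eqI) (simp add: scalar_op.rep_eq bounded_opsD)

lemma scalar_op_diff: "scalar_op (c - d) = scalar_op c - scalar_op d"
  by (metis add_diff_cancel_right' diff_add_cancel scalar_op_add)

lemma scalar_op_uminus: "scalar_op (- c) = - scalar_op c"
  using scalar_op_diff[of 0 c] by simp

lemma norm_scalar_op_le: "norm (scalar_op c) \<le> cmod c"
  by (rule norm_blinfun_bound) (simp_all add: scalar_op.rep_eq norm_scaleC)

lemma compose_id [simp]: "T o\<^sub>L id_blinfun = T" "id_blinfun o\<^sub>L T = T"
  by (rule blinfun_eqI, simp)+

lemma compose_assoc: "(S o\<^sub>L T) o\<^sub>L U = S o\<^sub>L (T o\<^sub>L U)"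
  by (rule blinfun_eqI) simp

lemmas compose_distribs =
  bounded_bilinear.add_left[OF bounded_bilinear_blinfun_compose]
  bounded_bilinear.add_right[OF bounded_bilinear_blinfun_compose]
  bounded_bilinear.diff_left[OF bounded_bilinear_blinfun_compose]
  bounded_bilinear.diff_right[OF bounded_bilinear_blinfun_compose]
  bounded_bilinear.scaleR_left[OF bounded_bilinear_blinfun_compose]
  bounded_bilinear.scaleR_right[OF bounded_bilinear_blinfun_compose]
  bounded_bilinear.minus_left[OF bounded_bilinear_blinfun_compose]
  bounded_bilinear.minus_right[OF bounded_bilinear_blinfun_compose]
  bounded_bilinear.zero_left[OF bounded_bilinear_blinfun_compose]
  bounded_bilinear.zero_right[OF bounded_bilinear_blinfun_compose]

section \<open>Invertibility and the Neumann series\<close>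

text \<open>The inverse of a bijective complex-linear map is automatically complex-linear, so a
  two-sided inverse may be sought among real-linear operators.\<close>

lemma invertible_opI:
  assumes "T \<in> bounded_ops" and "S o\<^sub>L T = id_blinfun" and "T o\<^sub>L S = id_blinfun"
  shows "invertible_op T"
proof -
  have TS: "blinfun_apply T (blinfun_apply S x) = x" for x
    using arg_cong[OF assms(3), of "\<lambda>U. blinfun_apply U x"] by simp
  have ST: "blinfun_apply S (blinfun_apply T x) = x" for x
    using arg_cong[OF assms(2), of "\<lambda>U. blinfun_apply U x"] by simp
  have "blinfun_apply S (c *\<^sub>C x) = c *\<^sub>C blinfun_apply S x" for c x
    by (metis TS ST bounded_opsD[OF assms(1)])
  then have "S \<in> bounded_ops" by (simp add: bounded_ops_def)
  then show ?thesis using assms unfolding invertible_op_def by blast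
qed

lemma invertible_op_compose:
  assumes "invertible_op S" "invertible_op T"
  shows "invertible_op (S o\<^sub>L T)"
proof -
  obtain S' T' where S': "S' \<in> bounded_ops" "S' o\<^sub>L S = id_blinfun" "S o\<^sub>L S' = id_blinfun"
    and T': "T' \<in> bounded_ops" "T' o\<^sub>L T = id_blinfun" "T o\<^sub>L T' = id_blinfun"
    using assms unfolding invertible_op_def by blast
  have "(T' o\<^sub>L S') o\<^sub>L (S o\<^sub>L T) = T' o\<^sub>L (S' o\<^sub>L S) o\<^sub>L T"
    by (simp only: compose_assoc)
  moreover have "(S o\<^sub>L T) o\<^sub>L (T' o\<^sub>L S') = S o\<^sub>L (T o\<^sub>L T') o\<^sub>L S'"
    by (simp only: compose_assoc)
  ultimately show ?thesis
    unfolding invertible_op_def using S' T' by (intro bexI[of _ "T' o\<^sub>L S'"]) auto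
qed

text \<open>If U inverts the product, then U S is a left inverse of T and, since S and T commute, S
  U is a right inverse; the two must coincide.\<close>

lemma invertible_op_left_factor:
  assumes "invertible_op (S o\<^sub>L T)" "S o\<^sub>L T = T o\<^sub>L S" "T \<in> bounded_ops"
  shows "invertible_op T"
proof -
  obtain U where U: "U o\<^sub>L (S o\<^sub>L T) = id_blinfun" "(S o\<^sub>L T) o\<^sub>L U = id_blinfun"
    using assms(1) unfolding invertible_op_def by blast
  have 1: "(U o\<^sub>L S) o\<^sub>L T = id_blinfun" using U by (simp add: compose_assoc)
  have 2: "T o\<^sub>L (S o\<^sub>L U) = id_blinfun" using U assms(2) by (metis compose_assoc)
  have "U o\<^sub>L S = S o\<^sub>L U"
    by (metis 1 2 compose_assoc compose_id)
  then show ?thesis using 1 2 invertible_opI[OF assms(3), of "U o\<^sub>L S"] by metis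
qed

lemma invertible_op_Neumann:
  fixes R :: "'a::chilbert \<Rightarrow>\<^sub>L 'a"
  assumes "R \<in> bounded_ops" "norm R < 1"
  shows "invertible_op (id_blinfun - R)"
proof -
  \<comment> \<open>\<open>pw n\<close> is the n-th power of \<open>R\<close>. The recursion is
    needed with \<open>R\<close> on either side, because shifting the series has to give both R S =
    S - 1 and S R = S - 1.\<close>
  define pw where "pw n = (((o\<^sub>L) R) ^^ n) id_blinfun" for n
  have pw_Suc: "pw (Suc n) = R o\<^sub>L pw n" for n by (simp add: pw_def)
  have pw_0: "pw 0 = id_blinfun" by (simp add: pw_def)
  have pw_Suc': "pw (Suc n) = pw n o\<^sub>L R" for n
  proof (induction n)
    case (Suc n)
    then show ?case by (metis pw_Suc compose_assoc)
  qed (simp add: pw_Suc pw_0)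
  have nrm: "norm (pw n) \<le> norm R ^ n" for n
  proof (induction n)
    case 0
    \<comment> \<open>Only an inequality: on the zero space the identity has norm 0.\<close>
    show ?case by (simp add: pw_0 norm_blinfun_id_le)
  next
    case (Suc n)
    have "norm (pw (Suc n)) \<le> norm R * norm (pw n)"
      unfolding pw_Suc by (rule norm_blinfun_compose)
    also have "\<dots> \<le> norm R * norm R ^ n" by (rule mult_left_mono[OF Suc]) simp
    finally show ?case by simp
  qed
  have sm: "summable pw"
    by (rule summable_comparison_test[of _ "\<lambda>n. norm R ^ n"])
      (use nrm assms(2) in \<open>auto intro: summable_geometric\<close>)
  define S where "S = suminf pw"
  have tail: "(\<Sum>n. pw (Suc n)) = S - id_blinfun"
    using suminf_split_head[OF sm] by (simp add: S_def pw_0)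
  have "R o\<^sub>L S = (\<Sum>n. R o\<^sub>L pw n)"
    unfolding S_def
    by (rule bounded_linear.suminf[OF bounded_bilinear.bounded_linear_right[OF bounded_bilinear_blinfun_compose] sm])
  then have 1: "R o\<^sub>L S = S - id_blinfun" using tail by (simp add: pw_Suc)
  have "S o\<^sub>L R = (\<Sum>n. pw n o\<^sub>L R)"
    unfolding S_def
    by (rule bounded_linear.suminf[OF bounded_bilinear.bounded_linear_left[OF bounded_bilinear_blinfun_compose] sm])
  then have 2: "S o\<^sub>L R = S - id_blinfun" using tail by (simp add: pw_Suc')
  show ?thesis
    by (rule invertible_opI[of _ S]) (use assms 1 2 in \<open>auto simp: compose_distribs\<close>)
qed

lemma invertible_op_scalar_compose:
  assumes "invertible_op T" "c \<noteq> 0"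
  shows "invertible_op (scalar_op c o\<^sub>L T)"
proof (rule invertible_op_compose[OF _ assms(1)])
  show "invertible_op (scalar_op c)"
    by (rule invertible_opI[of _ "scalar_op (1 / c)"])
      (use assms(2) in \<open>simp_all add: scalar_op_mult[symmetric] scalar_op_1\<close>)
qed

lemma invertible_op_scaleR: "invertible_op T \<Longrightarrow> r \<noteq> 0 \<Longrightarrow> invertible_op (r *\<^sub>R T)"
  using invertible_op_scalar_compose[of T "complex_of_real r"]
  by (simp add: scalar_op_of_real compose_distribs)

section \<open>Positivity and spectrum\<close>

lemma selfadjoint_opD: "selfadjoint_op S \<Longrightarrow> cinner (S x) y = cinner x (S y)"
  by (simp add: selfadjoint_op_def is_adjoint_def)

lemma selfadjoint_op_bounded_ops: "selfadjoint_op S \<Longrightarrow> S \<in> bounded_ops"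
  by (simp add: selfadjoint_op_def)

lemma selfadjoint_op_id [simp]: "selfadjoint_op id_blinfun"
  by (simp add: selfadjoint_op_def is_adjoint_def)

lemma selfadjoint_op_add: "selfadjoint_op S \<Longrightarrow> selfadjoint_op T \<Longrightarrow> selfadjoint_op (S + T)"
  by (auto simp: selfadjoint_op_def is_adjoint_def blinfun.add_left cinner_add_left cinner_add_right)

lemma selfadjoint_op_diff: "selfadjoint_op S \<Longrightarrow> selfadjoint_op T \<Longrightarrow> selfadjoint_op (S - T)"
  by (auto simp: selfadjoint_op_def is_adjoint_def blinfun.diff_left cinner.diff_left cinner.diff_right)

lemma selfadjoint_op_scaleR: "selfadjoint_op S \<Longrightarrow> selfadjoint_op (r *\<^sub>R S)"
  by (auto simp: selfadjoint_op_def is_adjoint_def blinfun.scaleR_left cinner_scaleR_left cinner_scaleR_right)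

lemma selfadjoint_op_sandwich:
  "selfadjoint_op C \<Longrightarrow> selfadjoint_op S \<Longrightarrow> selfadjoint_op (C o\<^sub>L S o\<^sub>L C)"
  by (auto simp: selfadjoint_op_def is_adjoint_def)

lemma selfadjoint_op_square: "selfadjoint_op S \<Longrightarrow> selfadjoint_op (S o\<^sub>L S)"
  by (auto simp: selfadjoint_op_def is_adjoint_def)

text \<open>Self-adjointness already makes the form real, so positivity can be tested on real
  parts.\<close>

lemma psd_op_iff:
  "psd_op T \<longleftrightarrow> selfadjoint_op T \<and> (\<forall>x. 0 \<le> Re (cinner x (blinfun_apply T x)))"
proof -
  have "Im (cinner x (blinfun_apply T x)) = 0" if "selfadjoint_op T" for x
    using cinner_commute[of x "blinfun_apply T x"] selfadjoint_opD[OF that, of x x]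
    by (simp add: complex_eq_iff)
  then show ?thesis
    by (auto simp: psd_op_def complex_nonneg_Reals_iff)
qed

lemma Re_cinner_op_le: "\<bar>Re (cinner x (blinfun_apply T x))\<bar> \<le> norm T * (norm x)\<^sup>2"
proof -
  have "\<bar>Re (cinner x (blinfun_apply T x))\<bar> \<le> norm x * norm (blinfun_apply T x)"
    by (rule Re_cinner_le)
  also have "\<dots> \<le> norm x * (norm T * norm x)"
    by (intro mult_left_mono norm_blinfun) simp
  finally show ?thesis by (simp add: power2_eq_square mult_ac)
qed

text \<open>With a square root of D this would be immediate; here the form is evaluated at x - D x /
  |D|. The cross term gives -2 |D x|^2 / |D|, and the form at D x contributes at most |D x|^2 /
  |D|.\<close>

lemma psd_op_norm_sq_le:
  assumes "psd_op D"
  shows "(norm (blinfun_apply D x))\<^sup>2 \<le> norm D * Re (cinner x (blinfun_apply D x))"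
proof (cases "norm D = 0")
  case True
  then show ?thesis by simp
next
  case False
  define t y where "t = - 1 / norm D" and "y = blinfun_apply D x"
  have sa: "selfadjoint_op D" using assms by (simp add: psd_op_iff)
  have xy: "Re (cinner x (blinfun_apply D y)) = (norm y)\<^sup>2" "Re (cinner y (blinfun_apply D x)) = (norm y)\<^sup>2"
    using selfadjoint_opD[OF sa, of x y] by (metis Re_complex_of_real Re_cinner_commute cinner_self y_def)+
  have "0 \<le> Re (cinner (x + t *\<^sub>R y) (blinfun_apply D (x + t *\<^sub>R y)))"
    using assms by (simp add: psd_op_iff)
  also have "\<dots> = Re (cinner x (blinfun_apply D x)) + 2 * t * (norm y)\<^sup>2
      + t\<^sup>2 * Re (cinner y (blinfun_apply D y))"
    using xy by (simp add: blinfun.add_right blinfun.scaleR_right cinner_add_left cinner_add_right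
        cinner_scaleR_left cinner_scaleR_right power2_eq_square algebra_simps)
  also have "\<dots> \<le> Re (cinner x (blinfun_apply D x)) + 2 * t * (norm y)\<^sup>2 + t\<^sup>2 * (norm D * (norm y)\<^sup>2)"
    using Re_cinner_op_le[of y D] by (intro add_left_mono mult_left_mono) auto
  also have "\<dots> = Re (cinner x (blinfun_apply D x)) - (norm y)\<^sup>2 / norm D"
    using False by (simp add: t_def field_simps power2_eq_square)
  finally show ?thesis
    using False by (simp add: y_def field_simps)
qed

text \<open>Normalise by c = |Q| + \<delta>: the form of R = 1 - Q/c then lies between 0 and k |x|^2
  with k = |Q|/c = 1 - \<delta>/c < 1. Hence R has norm below 1, and Q = c (1 - R) is invertible by
  the Neumann series.\<close>

lemma invertible_op_if_bounded_below:
  fixes Q :: "'a::chilbert \<Rightarrow>\<^sub>L 'a"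
  assumes "selfadjoint_op Q" "\<delta> > 0"
    and "\<And>x. \<delta> * (norm x)\<^sup>2 \<le> Re (cinner x (blinfun_apply Q x))"
  shows "invertible_op Q"
proof -
  define c where "c = norm Q + \<delta>"
  have c: "c > 0" using assms(2) by (simp add: c_def add_nonneg_pos)
  define R where "R = id_blinfun - (1 / c) *\<^sub>R Q"
  define k where "k = norm Q / c"
  have k: "0 \<le> k" "k < 1" using c assms(2) by (simp_all add: k_def c_def)
  have qR: "Re (cinner x (blinfun_apply R x)) = (norm x)\<^sup>2 - Re (cinner x (blinfun_apply Q x)) / c" for x
    by (simp add: R_def blinfun.diff_left blinfun.scaleR_left cinner.diff_right cinner_scaleR_right cinner_self)
  have saR: "selfadjoint_op R"
    unfolding R_def by (intro selfadjoint_op_diff selfadjoint_op_scaleR assms) simp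
  have psd: "psd_op R"
  proof -
    have "Re (cinner x (blinfun_apply Q x)) \<le> c * (norm x)\<^sup>2" for x
      using Re_cinner_op_le[of x Q] assms(2) by (simp add: c_def distrib_right add_increasing2)
    then show ?thesis using c saR by (auto simp: psd_op_iff qR field_simps)
  qed
  have le: "Re (cinner x (blinfun_apply R x)) \<le> k * (norm x)\<^sup>2" for x
  proof -
    have "\<delta> * (norm x)\<^sup>2 / c \<le> Re (cinner x (blinfun_apply Q x)) / c"
      using assms(3)[of x] c by (simp add: divide_right_mono)
    moreover have "\<delta> * (norm x)\<^sup>2 / c = (norm x)\<^sup>2 - k * (norm x)\<^sup>2"
      using c by (simp add: k_def c_def field_simps)
    ultimately show ?thesis unfolding qR by linarith
  qed
  have "norm (blinfun_apply R x) \<le> sqrt (norm R * k) * norm x" for x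
  proof -
    have "(norm (blinfun_apply R x))\<^sup>2 \<le> norm R * (k * (norm x)\<^sup>2)"
      using psd_op_norm_sq_le[OF psd, of x] mult_left_mono[OF le[of x], of "norm R"] by simp
    then have "sqrt ((norm (blinfun_apply R x))\<^sup>2) \<le> sqrt (norm R * k * (norm x)\<^sup>2)"
      by (simp only: mult.assoc real_sqrt_le_iff)
    then show ?thesis by (simp add: real_sqrt_mult)
  qed
  \<comment> \<open>The bound contains \<open>norm R\<close> on both sides; squaring and cancelling
    leaves \<open>norm R \<le> k\<close>.\<close>
  then have "norm R \<le> sqrt (norm R * k)"
    using k by (intro norm_blinfun_bound) auto
  then have "(norm R)\<^sup>2 \<le> norm R * k"
    using k by (metis mult_nonneg_nonneg norm_ge_zero real_le_rsqrt real_sqrt_ge_zero real_sqrt_pow2 power_mono)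
  then have "norm R < 1"
    using k by (cases "norm R = 0") (auto simp: power2_eq_square mult_le_cancel_left)
  then have "invertible_op (id_blinfun - R)"
    using saR by (intro invertible_op_Neumann) (auto simp: selfadjoint_op_bounded_ops)
  then have "invertible_op (c *\<^sub>R (id_blinfun - R))"
    using c by (intro invertible_op_scaleR) auto
  then show ?thesis using c by (simp add: R_def)
qed

lemma invertible_psd_op_bounded_below:
  fixes D :: "'a::chilbert \<Rightarrow>\<^sub>L 'a"
  assumes "psd_op D" "invertible_op D"
  obtains c where "c > 0" "\<And>x. c * (norm x)\<^sup>2 \<le> Re (cinner x (blinfun_apply D x))"
proof -
  obtain E where E: "E o\<^sub>L D = id_blinfun"
    using assms(2) unfolding invertible_op_def by blast
  \<comment> \<open>The summand 1 keeps \<open>k\<close> positive even on the zero space, where both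
    norms vanish.\<close>
  define k where "k = (norm E)\<^sup>2 * norm D + 1"
  have k: "k > 0" by (simp add: k_def add_nonneg_pos)
  have "(norm x)\<^sup>2 \<le> k * Re (cinner x (blinfun_apply D x))" for x
  proof -
    have q: "0 \<le> Re (cinner x (blinfun_apply D x))"
      using assms(1) by (simp add: psd_op_iff)
    have "x = blinfun_apply E (blinfun_apply D x)"
      using arg_cong[OF E, of "\<lambda>U. blinfun_apply U x"] by simp
    then have "norm x \<le> norm E * norm (blinfun_apply D x)"
      by (metis norm_blinfun)
    then have "(norm x)\<^sup>2 \<le> (norm E)\<^sup>2 * (norm (blinfun_apply D x))\<^sup>2"
      by (metis norm_ge_zero power_mono power_mult_distrib)
    also have "\<dots> \<le> (norm E)\<^sup>2 * (norm D * Re (cinner x (blinfun_apply D x)))"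
      by (intro mult_left_mono psd_op_norm_sq_le assms) simp
    also have "\<dots> \<le> k * Re (cinner x (blinfun_apply D x))"
      using q by (simp add: k_def distrib_right)
    finally show ?thesis .
  qed
  then show thesis
    using k by (intro that[of "1 / k"]) (auto simp: field_simps)
qed

text \<open>Let \<mu> be the infimum of the form over the unit sphere. If \<mu> < m, then S - \<mu>
  is positive and invertible, so its form is bounded below by some c > 0. Then \<mu> + c would still
  be a lower bound, contradicting the choice of \<mu>.\<close>

lemma selfadjoint_op_lower_bound:
  fixes S :: "'a::chilbert \<Rightarrow>\<^sub>L 'a"
  assumes sa: "selfadjoint_op S"
    and inv: "\<And>r. r < m \<Longrightarrow> invertible_op (S - r *\<^sub>R id_blinfun)"
  shows "m * (norm x)\<^sup>2 \<le> Re (cinner x (blinfun_apply S x))"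
proof (rule ccontr)
  define q where "q y = Re (cinner y (blinfun_apply S y))" for y
  have q_scale: "q (r *\<^sub>R y) = r\<^sup>2 * q y" for r y
    by (simp add: q_def blinfun.scaleR_right cinner_scaleR_left cinner_scaleR_right power2_eq_square)
  assume "\<not> ?thesis"
  then have lt: "q x < m * (norm x)\<^sup>2" by (simp add: q_def)
  then have x: "norm x > 0" by (auto simp: q_def cinner.zero_left)
  define W where "W = q ` {y. norm y = 1}"
  define \<mu> where "\<mu> = Inf W"
  have ge: "- norm S \<le> w" if "w \<in> W" for w
  proof -
    obtain y where y: "w = q y" "norm y = 1"
      using \<open>w \<in> W\<close> by (auto simp: W_def)
    then show ?thesis
      using Re_cinner_op_le[of y S] by (simp add: q_def)
  qed
  then have bdd: "bdd_below W" by (auto simp: bdd_below_def)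
  have low: "\<mu> * (norm y)\<^sup>2 \<le> q y" for y
  proof (cases "y = 0")
    case False
    have "q ((1 / norm y) *\<^sub>R y) \<in> W" using False by (auto simp: W_def)
    then have "\<mu> \<le> q ((1 / norm y) *\<^sub>R y)"
      unfolding \<mu>_def by (rule cInf_lower[OF _ bdd])
    then show ?thesis using False by (simp add: q_scale field_simps)
  qed (simp add: q_def cinner.zero_left)
  have "\<mu> * (norm x)\<^sup>2 < m * (norm x)\<^sup>2" using low[of x] lt by simp
  then have "\<mu> < m" using x by simp
  define D where "D = S - \<mu> *\<^sub>R id_blinfun"
  have qD: "Re (cinner y (blinfun_apply D y)) = q y - \<mu> * (norm y)\<^sup>2" for y
    by (simp add: D_def q_def blinfun.diff_left blinfun.scaleR_left cinner.diff_right
        cinner_scaleR_right cinner_self)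
  have "psd_op D"
    using low sa by (auto simp: psd_op_iff qD) (simp add: D_def selfadjoint_op_diff selfadjoint_op_scaleR)
  moreover have "invertible_op D" using inv[OF \<open>\<mu> < m\<close>] by (simp add: D_def)
  ultimately obtain c where c: "c > 0" "\<And>y. c * (norm y)\<^sup>2 \<le> Re (cinner y (blinfun_apply D y))"
    by (rule invertible_psd_op_bounded_below) blast
  have "\<mu> + c \<le> Inf W"
  proof (rule cInf_greatest)
    show "W \<noteq> {}"
    proof -
      have "norm ((1 / norm x) *\<^sub>R x) = 1" using x by simp
      then show ?thesis unfolding W_def by blast
    qed
    show "\<mu> + c \<le> w" if "w \<in> W" for w
    proof -
      obtain y where "w = q y" "norm y = 1"
        using \<open>w \<in> W\<close> by (auto simp: W_def)
      then show ?thesis using c(2)[of y] by (simp add: qD)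
    qed
  qed
  then show False using c(1) by (simp add: \<mu>_def)
qed

section \<open>Reality and compactness of the spectrum\<close>

text \<open>Write T - z = U - J with U = T - Re z self-adjoint and J = \<i> Im z. The factors
  commute and (U + J)(U - J) = U^2 + (Im z)^2, whose form is at least (Im z)^2 |x|^2; so U - J is
  invertible unless Im z = 0.\<close>

lemma op_spectrum_real:
  fixes T :: "'a::chilbert \<Rightarrow>\<^sub>L 'a"
  assumes "selfadjoint_op T" "z \<in> op_spectrum T"
  shows "z = complex_of_real (Re z)"
proof (rule ccontr)
  assume "z \<noteq> complex_of_real (Re z)"
  then have b: "Im z \<noteq> 0" by (simp add: complex_eq_iff)
  define U J where "U = T - Re z *\<^sub>R id_blinfun" and "J = (scalar_op (\<i> * Im z) :: 'a \<Rightarrow>\<^sub>L 'a)"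
  have saU: "selfadjoint_op U"
    unfolding U_def by (intro selfadjoint_op_diff selfadjoint_op_scaleR assms) simp
  have "scalar_op z = Re z *\<^sub>R id_blinfun + J"
    unfolding J_def scalar_op_of_real[symmetric] scalar_op_add[symmetric]
    by (simp only: complex_eq[symmetric])
  then have z: "T - scalar_op z = U - J"
    by (simp add: U_def)
  have UJ: "U o\<^sub>L J = J o\<^sub>L U"
    unfolding J_def by (rule scalar_op_commute) (rule selfadjoint_op_bounded_ops[OF saU])
  have "J o\<^sub>L J = scalar_op (complex_of_real (- ((Im z)\<^sup>2)))"
    unfolding J_def by (simp add: scalar_op_mult[symmetric] power2_eq_square algebra_simps)
  then have JJ: "J o\<^sub>L J = - ((Im z)\<^sup>2) *\<^sub>R id_blinfun" by (simp only: scalar_op_of_real)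
  have eq: "(U + J) o\<^sub>L (U - J) = (U o\<^sub>L U) + (Im z)\<^sup>2 *\<^sub>R id_blinfun"
    "(U - J) o\<^sub>L (U + J) = (U o\<^sub>L U) + (Im z)\<^sup>2 *\<^sub>R id_blinfun"
    by (simp_all add: compose_distribs UJ JJ)
  have "invertible_op ((U + J) o\<^sub>L (U - J))"
    unfolding eq
  proof (rule invertible_op_if_bounded_below)
    show "selfadjoint_op ((U o\<^sub>L U) + (Im z)\<^sup>2 *\<^sub>R id_blinfun)"
      by (intro selfadjoint_op_add selfadjoint_op_square selfadjoint_op_scaleR saU) simp
    show "(Im z)\<^sup>2 > 0" using b by simp
    show "(Im z)\<^sup>2 * (norm x)\<^sup>2
      \<le> Re (cinner x (blinfun_apply ((U o\<^sub>L U) + (Im z)\<^sup>2 *\<^sub>R id_blinfun) x))" for x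
      by (simp add: blinfun.add_left blinfun.scaleR_left cinner_add_right cinner_scaleR_right
          cinner_self selfadjoint_opD[OF saU, symmetric])
  qed
  then have "invertible_op (U - J)"
    by (rule invertible_op_left_factor)
      (use eq selfadjoint_op_bounded_ops[OF saU] in \<open>auto simp: J_def\<close>)
  then show False using assms(2) by (simp add: op_spectrum_def z)
qed

lemma op_spectrum_bounded:
  fixes T :: "'a::chilbert \<Rightarrow>\<^sub>L 'a"
  assumes "T \<in> bounded_ops" "z \<in> op_spectrum T"
  shows "cmod z \<le> norm T"
proof (rule ccontr)
  assume "\<not> ?thesis"
  then have lt: "norm T < cmod z" by simp
  then have z: "z \<noteq> 0" by (metis norm_ge_zero norm_zero not_le)
  have "norm (scalar_op (1 / z) o\<^sub>L T) \<le> cmod (1 / z) * norm T"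
    by (rule order_trans[OF norm_blinfun_compose]) (simp add: mult_right_mono norm_scalar_op_le)
  also have "\<dots> < 1" using lt z by (simp add: norm_divide)
  finally have "invertible_op (id_blinfun - (scalar_op (1 / z) o\<^sub>L T))"
    by (intro invertible_op_Neumann) (use assms in auto)
  then have "invertible_op (scalar_op (- z) o\<^sub>L (id_blinfun - (scalar_op (1 / z) o\<^sub>L T)))"
    using z by (intro invertible_op_scalar_compose) auto
  also have "scalar_op (- z) o\<^sub>L (id_blinfun - (scalar_op (1 / z) o\<^sub>L T))
      = scalar_op (0 - z) - (scalar_op ((- z) * (1 / z)) o\<^sub>L T)"
    by (simp only: compose_distribs compose_id scalar_op_mult compose_assoc diff_0)
  also have "\<dots> = T - scalar_op z"
    using z by (simp add: scalar_op_uminus scalar_op_1 compose_distribs)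
  finally show False using assms(2) by (simp add: op_spectrum_def)
qed

text \<open>If E inverts T - z, then T - w = (T - z)(1 - E (w - z)), and the second factor is a
  Neumann perturbation of the identity once |w - z| < 1 / (|E| + 1). Adding 1 avoids a division by
  zero.\<close>

lemma closed_op_spectrum:
  fixes T :: "'a::chilbert \<Rightarrow>\<^sub>L 'a"
  assumes "T \<in> bounded_ops"
  shows "closed (op_spectrum T)"
  unfolding closed_def open_dist
proof safe
  fix z assume "z \<notin> op_spectrum T"
  then obtain E where E: "E \<in> bounded_ops" "(T - scalar_op z) o\<^sub>L E = id_blinfun"
    "invertible_op (T - scalar_op z)"
    unfolding op_spectrum_def invertible_op_def by auto
  have pos: "norm E + 1 > 0" by (simp add: add_nonneg_pos)
  have "w \<notin> op_spectrum T" if "dist w z < 1 / (norm E + 1)" for w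
  proof -
    have "norm (E o\<^sub>L scalar_op (w - z)) \<le> norm E * cmod (w - z)"
      by (rule order_trans[OF norm_blinfun_compose]) (simp add: mult_left_mono norm_scalar_op_le)
    also have "\<dots> \<le> (norm E + 1) * cmod (w - z)" by (simp add: mult_right_mono)
    also have "\<dots> < 1" using that pos by (simp add: dist_norm field_simps)
    finally have "invertible_op (id_blinfun - (E o\<^sub>L scalar_op (w - z)))"
      by (intro invertible_op_Neumann) (use E in auto)
    then have "invertible_op ((T - scalar_op z) o\<^sub>L (id_blinfun - (E o\<^sub>L scalar_op (w - z))))"
      by (intro invertible_op_compose E)
    also have "(T - scalar_op z) o\<^sub>L (id_blinfun - (E o\<^sub>L scalar_op (w - z)))
      = (T - scalar_op z) - (((T - scalar_op z) o\<^sub>L E) o\<^sub>L scalar_op (w - z))"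
      by (simp only: compose_distribs compose_id compose_assoc)
    also have "\<dots> = T - scalar_op w" unfolding E(2) by (simp add: scalar_op_diff)
    finally show ?thesis by (simp add: op_spectrum_def)
  qed
  then show "\<exists>e>0. \<forall>w. dist w z < e \<longrightarrow> w \<in> - op_spectrum T"
    using pos by (intro exI[of _ "1 / (norm E + 1)"]) auto
qed

lemma compact_op_spectrum: "T \<in> bounded_ops \<Longrightarrow> compact (op_spectrum T)"
  unfolding compact_eq_bounded_closed
  using closed_op_spectrum op_spectrum_bounded by (auto simp: bounded_iff)

section \<open>Polynomials in an operator\<close>

text \<open>Horner's scheme, with the complex coefficients entering as the operators
  \<open>scalar_op a\<close>.\<close>

definition op_poly :: "('a::chilbert \<Rightarrow>\<^sub>L 'a) \<Rightarrow> complex poly \<Rightarrow> ('a \<Rightarrow>\<^sub>L 'a)" where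
  "op_poly T p = fold_coeffs (\<lambda>a S. scalar_op a + (T o\<^sub>L S)) p 0"

lemma op_poly_0 [simp]: "op_poly T 0 = 0"
  by (simp add: op_poly_def)

lemma op_poly_pCons: "op_poly T (pCons a p) = scalar_op a + (T o\<^sub>L op_poly T p)"
  \<comment> \<open>\<open>pCons 0 0\<close> is the zero polynomial, on which the fold does not
    perform a step, so this case is evaluated separately.\<close>
  by (cases "p = 0 \<and> a = 0") (auto simp: op_poly_def compose_distribs)

lemma op_poly_const: "op_poly T [:c:] = scalar_op c"
  by (simp add: op_poly_pCons compose_distribs)

lemma op_poly_linear: "op_poly T [:c, 1:] = scalar_op c + T"
  by (simp add: op_poly_pCons compose_distribs scalar_op_1)

lemma op_poly_add: "op_poly T (p + q) = op_poly T p + op_poly T q"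
  by (induction p q rule: poly_induct2) (simp_all add: op_poly_pCons scalar_op_add compose_distribs)

lemma op_poly_diff: "op_poly T (p - q) = op_poly T p - op_poly T q"
  by (metis add_diff_cancel_right' diff_add_cancel op_poly_add)

context
  fixes T :: "'a::chilbert \<Rightarrow>\<^sub>L 'a"
  assumes T: "T \<in> bounded_ops"
begin

lemma op_poly_bounded_ops: "op_poly T p \<in> bounded_ops"
  by (induction p) (auto simp: op_poly_pCons intro!: bounded_ops_add bounded_ops_compose T)

lemma op_poly_smult: "op_poly T (smult c p) = scalar_op c o\<^sub>L op_poly T p"
proof (induction p)
  case (pCons a p)
  have "T o\<^sub>L (scalar_op c o\<^sub>L op_poly T p) = scalar_op c o\<^sub>L (T o\<^sub>L op_poly T p)"
    by (metis T compose_assoc scalar_op_commute)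
  then show ?case by (simp add: op_poly_pCons pCons compose_distribs scalar_op_mult)
qed (simp add: compose_distribs)

lemma op_poly_mult: "op_poly T (p * q) = op_poly T p o\<^sub>L op_poly T q"
proof (induction p)
  case (pCons a p)
  then show ?case
    by (simp add: op_poly_pCons op_poly_add op_poly_smult compose_distribs compose_assoc)
qed (simp add: compose_distribs)

text \<open>One inclusion of the spectral mapping theorem. A root z of p lies off the spectrum, so T
  - z is invertible; splitting off this linear factor lowers the degree.\<close>

lemma invertible_op_poly:
  assumes "p \<noteq> 0" "\<And>z. z \<in> op_spectrum T \<Longrightarrow> poly p z \<noteq> 0"
  shows "invertible_op (op_poly T p)"
  using assms
proof (induction "degree p" arbitrary: p)
  case 0
  then obtain c where p: "p = [:c:]" by (metis degree_eq_zeroE)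
  then have "c \<noteq> 0" using 0 by simp
  then show ?case
    by (intro invertible_opI[of _ "scalar_op (1 / c)"])
      (simp_all add: p op_poly_const scalar_op_mult[symmetric] scalar_op_1)
next
  case (Suc n)
  have "\<not> constant (poly p)" using Suc.hyps(2) by (simp add: constant_degree)
  then obtain z where z: "poly p z = 0" using fundamental_theorem_of_algebra by blast
  then obtain q where p: "p = [:- z, 1:] * q" using poly_eq_0_iff_dvd by blast
  have q: "q \<noteq> 0" using p Suc.prems(1) by auto
  then have "degree p = degree [:- z, 1:] + degree q"
    unfolding p by (intro degree_mult_eq) auto
  then have "n = degree q" using Suc.hyps(2) by simp
  moreover have "poly q w \<noteq> 0" if "w \<in> op_spectrum T" for w
    using Suc.prems(2)[OF that] by (auto simp: p)
  ultimately have "invertible_op (op_poly T q)" using Suc.hyps(1) q by blast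
  moreover have "invertible_op (op_poly T [:- z, 1:])"
  proof -
    have "z \<notin> op_spectrum T" using z Suc.prems(2) by blast
    then show ?thesis by (simp add: op_spectrum_def op_poly_linear scalar_op_uminus)
  qed
  ultimately show ?case unfolding p op_poly_mult by (rule invertible_op_compose[rotated])
qed

end

lemma is_adjoint_sym: "is_adjoint S T \<Longrightarrow> is_adjoint T S"
  unfolding is_adjoint_def by (metis cinner_commute)

lemma is_adjoint_add: "is_adjoint S T \<Longrightarrow> is_adjoint S' T' \<Longrightarrow> is_adjoint (S + S') (T + T')"
  by (simp add: is_adjoint_def blinfun.add_left cinner_add_left cinner_add_right)

lemma is_adjoint_compose: "is_adjoint S T \<Longrightarrow> is_adjoint S' T' \<Longrightarrow> is_adjoint (S o\<^sub>L S') (T' o\<^sub>L T)"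
  by (simp add: is_adjoint_def)

lemma is_adjoint_scalar_op: "is_adjoint (scalar_op (cnj c)) (scalar_op c)"
  by (simp add: is_adjoint_def scalar_op.rep_eq cinner_scaleC_left cinner_scaleC_right)

lemma norm_apply_sq_adjoint:
  assumes "is_adjoint S T"
  shows "cinner x (blinfun_apply (S o\<^sub>L T) x) = complex_of_real ((norm (blinfun_apply T x))\<^sup>2)"
  using is_adjoint_sym[OF assms] by (simp add: is_adjoint_def cinner_self[symmetric] del: of_real_power)

lemma op_poly_is_adjoint:
  assumes "selfadjoint_op T"
  shows "is_adjoint (op_poly T (map_poly cnj p)) (op_poly T p)"
proof (induction p)
  case 0
  show ?case by (simp add: is_adjoint_def cinner.zero_left cinner.zero_right)
next
  case (pCons a p)
  have T: "T \<in> bounded_ops" "is_adjoint T T" using assms by (auto simp: selfadjoint_op_def)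
  \<comment> \<open>Horner's step with \<open>T\<close> on the right: the adjoint reverses
    compositions, so this form is the one whose adjoint is again a Horner step.\<close>
  have "op_poly T (pCons a p) = scalar_op a + (op_poly T p o\<^sub>L T)"
    using op_poly_mult[OF T(1), of "[:0, 1:]" p] op_poly_mult[OF T(1), of p "[:0, 1:]"]
    by (simp add: op_poly_pCons mult.commute scalar_op_1 compose_distribs)
  then show ?case
    by (simp add: map_poly_pCons op_poly_pCons is_adjoint_add is_adjoint_scalar_op
        is_adjoint_compose pCons T)
qed

text \<open>With empty spectrum the lower bound for the form holds at every level; at level |T| + 1
  it exceeds the upper bound |T| unless x = 0.\<close>

lemma op_spectrum_empty:
  fixes T :: "'a::chilbert \<Rightarrow>\<^sub>L 'a"
  assumes "selfadjoint_op T" "op_spectrum T = {}"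
  shows "x = (0::'a)"
proof -
  define r where "r = norm T + 1"
  have "r * (norm x)\<^sup>2 \<le> Re (cinner x (blinfun_apply T x))"
  proof (rule selfadjoint_op_lower_bound[OF assms(1)])
    show "invertible_op (T - s *\<^sub>R id_blinfun)" for s
      using assms(2) unfolding op_spectrum_def scalar_op_of_real[symmetric] by blast
  qed
  also have "\<dots> \<le> norm T * (norm x)\<^sup>2" using Re_cinner_op_le[of x T] by simp
  finally show ?thesis by (simp add: r_def distrib_right)
qed

text \<open>The form of \<open>M\<^sup>2 - p(T)\<^sup>* p(T)\<close> is nonnegative because its spectrum, by the fundamental
  theorem of algebra, consists of values of the nonnegative function \<open>M\<^sup>2 - \<bar>p\<bar>\<^sup>2\<close>.\<close>

lemma norm_op_poly_le:
  fixes T :: "'a::chilbert \<Rightarrow>\<^sub>L 'a"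
  assumes sa: "selfadjoint_op T" and M: "0 \<le> M"
    and le: "\<And>z. z \<in> op_spectrum T \<Longrightarrow> cmod (poly p z) \<le> M"
  shows "norm (op_poly T p) \<le> M"
proof (rule norm_blinfun_bound[OF M])
  fix x
  note T = selfadjoint_op_bounded_ops[OF sa]
  \<comment> \<open>On real arguments, and hence on the spectrum, \<open>q\<close> takes the values
    |p(z)|^2.\<close>
  define q where "q = map_poly cnj p * p"
  define S where "S = M\<^sup>2 *\<^sub>R id_blinfun - op_poly T q"
  have q: "op_poly T q = op_poly T (map_poly cnj p) o\<^sub>L op_poly T p"
    by (simp add: q_def op_poly_mult[OF T])
  show "norm (blinfun_apply (op_poly T p) x) \<le> M * norm x"
  proof (cases "op_spectrum T = {}")
    case True
    then have "x = 0" by (rule op_spectrum_empty[OF sa])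
    then show ?thesis by simp
  next
    case False
    have adj: "is_adjoint (op_poly T (map_poly cnj p)) (op_poly T p)"
      by (rule op_poly_is_adjoint[OF sa])
    have saS: "selfadjoint_op S"
      unfolding S_def
    proof (intro selfadjoint_op_diff selfadjoint_op_scaleR selfadjoint_op_id)
      show "selfadjoint_op (op_poly T q)"
        unfolding selfadjoint_op_def using is_adjoint_compose[OF adj is_adjoint_sym[OF adj]]
        by (simp add: op_poly_bounded_ops[OF T]) (simp add: q)
    qed
    have "0 * (norm x)\<^sup>2 \<le> Re (cinner x (blinfun_apply S x))"
    proof (rule selfadjoint_op_lower_bound[OF saS])
      fix s :: real assume "s < 0"
      \<comment> \<open>Chosen so that r(T) = S - s; on the spectrum r(z) = M^2 - s - |p(z)|^2 is
        positive because s < 0.\<close>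
      define r where "r = [:complex_of_real (M\<^sup>2 - s):] - q"
      have "poly r z \<noteq> 0" if z: "z \<in> op_spectrum T" for z
      proof -
        have "cnj z = z" using op_spectrum_real[OF sa z] by (metis complex_cnj_complex_of_real)
        then have "poly r z = complex_of_real (M\<^sup>2 - s) - cnj (poly p z) * poly p z"
          by (simp add: r_def q_def)
        also have "cnj (poly p z) * poly p z = complex_of_real ((cmod (poly p z))\<^sup>2)"
          by (metis complex_norm_square mult.commute)
        finally have "poly r z = complex_of_real (M\<^sup>2 - s - (cmod (poly p z))\<^sup>2)"
          by (simp only: of_real_diff)
        moreover have "(cmod (poly p z))\<^sup>2 \<le> M\<^sup>2" using le[OF z] by (simp add: power_mono)
        ultimately have "poly r z = complex_of_real (M\<^sup>2 - s - (cmod (poly p z))\<^sup>2)"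
          "M\<^sup>2 - s - (cmod (poly p z))\<^sup>2 \<noteq> 0"
          using \<open>s < 0\<close> by (blast, linarith)
        then show ?thesis by (metis of_real_eq_0_iff)
      qed
      \<comment> \<open>A point of the spectrum, where \<open>r\<close> does not vanish, shows that
        \<open>r\<close> is not the zero polynomial.\<close>
      then have "r \<noteq> 0" "\<And>z. z \<in> op_spectrum T \<Longrightarrow> poly r z \<noteq> 0" using False by auto
      then have "invertible_op (op_poly T r)" by (rule invertible_op_poly[OF T])
      then have "invertible_op (M\<^sup>2 *\<^sub>R id_blinfun - s *\<^sub>R id_blinfun - op_poly T q)"
        by (simp only: r_def op_poly_diff op_poly_const scalar_op_of_real scaleR_left_diff_distrib)
      then show "invertible_op (S - s *\<^sub>R id_blinfun)"
        unfolding S_def by (simp only: diff_diff_eq add.commute)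
    qed
    also have "Re (cinner x (blinfun_apply S x)) = M\<^sup>2 * (norm x)\<^sup>2 - (norm (blinfun_apply (op_poly T p) x))\<^sup>2"
      unfolding S_def q blinfun.diff_left blinfun.scaleR_left cinner.diff_right
        norm_apply_sq_adjoint[OF adj, of x] id_blinfun.rep_eq id_apply cinner_scaleR_right cinner_self
      by (simp only: minus_complex.sel scaleR_complex.sel Re_complex_of_real)
    finally have "(norm (blinfun_apply (op_poly T p) x))\<^sup>2 \<le> (M * norm x)\<^sup>2"
      by (simp add: power_mult_distrib)
    then show ?thesis by (rule power2_le_imp_le) (simp add: M)
  qed
qed

section \<open>Polynomial approximation on real compact sets\<close>

lemma of_real_poly_map_poly: "poly (map_poly of_real p) (complex_of_real x) = complex_of_real (poly p x)"
  by (induction p) (simp_all add: map_poly_pCons)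

text \<open>The points of K are real, so they are separated by the real part, and real polynomials
  in \<open>Re z\<close> form an algebra to which the real Stone-Weierstrass theorem
  applies.\<close>

lemma real_poly_approx:
  fixes f :: "complex \<Rightarrow> real"
  assumes "compact K" "\<And>z. z \<in> K \<Longrightarrow> z = complex_of_real (Re z)" "continuous_on K f" "e > 0"
  obtains p where "\<And>z. z \<in> K \<Longrightarrow> \<bar>f z - poly p (Re z)\<bar> < e"
proof -
  define P where "P g \<longleftrightarrow> (\<exists>p::real poly. g = (\<lambda>z. poly p (Re z)))" for g
  have "\<exists>g. P g \<and> (\<forall>z\<in>K. \<bar>f z - g z\<bar> < e)"
  proof (rule Stone_Weierstrass_HOL)
    show "P (\<lambda>x. c)" for c unfolding P_def by (rule exI[of _ "[:c:]"]) simp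
    show "continuous_on K g" if "P g" for g
      using that by (auto simp: P_def intro!: continuous_intros)
    show "P (\<lambda>x. g x + h x)" if *: "P g \<and> P h" for g h
      proof -
      obtain p q where "g = (\<lambda>z. poly p (Re z))" "h = (\<lambda>z. poly q (Re z))"
        using * unfolding P_def by blast
      then show ?thesis unfolding P_def by (intro exI[of _ "p + q"]) simp
    qed
    show "P (\<lambda>x. g x * h x)" if *: "P g \<and> P h" for g h
      proof -
      obtain p q where "g = (\<lambda>z. poly p (Re z))" "h = (\<lambda>z. poly q (Re z))"
        using * unfolding P_def by blast
      then show ?thesis unfolding P_def by (intro exI[of _ "p * q"]) simp
    qed
    show "\<exists>g. P g \<and> g x \<noteq> g y" if "x \<in> K \<and> y \<in> K \<and> x \<noteq> y" for x y
    proof (intro exI[of _ Re] conjI)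
      show "P Re" unfolding P_def by (rule exI[of _ "[:0, 1:]"]) auto
      show "Re x \<noteq> Re y" using that assms(2) by metis
    qed
  qed (use assms in auto)
  then show thesis using that unfolding P_def by blast
qed

text \<open>Real and imaginary parts are approximated separately and recombined with the factor
  \<i>; on K a polynomial in z is the same as one in \<open>Re z\<close>.\<close>

lemma poly_approx:
  fixes f :: "complex \<Rightarrow> complex"
  assumes K: "compact K" "\<And>z. z \<in> K \<Longrightarrow> z = complex_of_real (Re z)" and f: "continuous_on K f"
  obtains P where "uniform_limit K (\<lambda>n::nat. poly (P n)) f sequentially"
proof -
  have ex: "\<exists>p. \<forall>z\<in>K. dist (poly p z) (f z) < e" if "e > 0" for e
  proof -
    have e2: "e / 2 > 0" using that by simp
    have cont: "continuous_on K (\<lambda>z. Re (f z))" "continuous_on K (\<lambda>z. Im (f z))"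
      using f by (auto intro!: continuous_intros)
    obtain u where u: "\<And>z. z \<in> K \<Longrightarrow> \<bar>Re (f z) - poly u (Re z)\<bar> < e / 2"
      by (rule real_poly_approx[OF K cont(1) e2]) auto
    obtain w where w: "\<And>z. z \<in> K \<Longrightarrow> \<bar>Im (f z) - poly w (Re z)\<bar> < e / 2"
      by (rule real_poly_approx[OF K cont(2) e2]) auto
    define p where "p = map_poly complex_of_real u + smult \<i> (map_poly complex_of_real w)"
    have "dist (poly p z) (f z) < e" if z: "z \<in> K" for z
    proof -
      have "poly p z = complex_of_real (poly u (Re z)) + \<i> * complex_of_real (poly w (Re z))"
        by (subst K(2)[OF z]) (simp add: p_def of_real_poly_map_poly)
      then have "cmod (poly p z - f z) \<le> \<bar>poly u (Re z) - Re (f z)\<bar> + \<bar>poly w (Re z) - Im (f z)\<bar>"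
        using cmod_le[of "poly p z - f z"] by simp
      then show ?thesis using u[OF z] w[OF z] unfolding dist_norm by linarith
    qed
    then show ?thesis by blast
  qed
  have "\<exists>P. \<forall>n::nat. \<forall>z\<in>K. dist (poly (P n) z) (f z) < 1 / real (Suc n)"
    by (intro choice allI ballI) (use ex in simp)
  then obtain P where P: "\<And>n z. z \<in> K \<Longrightarrow> dist (poly (P n) z) (f z) < 1 / real (Suc n)" by blast
  have "uniform_limit K (\<lambda>n. poly (P n)) f sequentially"
  proof (rule uniform_limitI)
    fix e :: real assume "e > 0"
    then have "\<forall>\<^sub>F n in sequentially. 1 / real (Suc n) < e"
      using order_tendstoD(2)[OF LIMSEQ_inverse_real_of_nat, of e] by (simp add: inverse_eq_divide)
    then show "\<forall>\<^sub>F n in sequentially. \<forall>z\<in>K. dist (poly (P n) z) (f z) < e"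
      by eventually_elim (use P in \<open>auto intro: less_trans\<close>)
  qed
  then show thesis by (rule that)
qed

section \<open>Existence and uniqueness of the functional calculus\<close>

text \<open>A relation with an existential sequence: any approximating polynomials may serve as
  witness, in particular ones that approximate on a larger compact set and so serve two operators at
  once.\<close>

definition fc_value ::
    "('a::chilbert \<Rightarrow>\<^sub>L 'a) \<Rightarrow> (complex \<Rightarrow> complex) \<Rightarrow> ('a \<Rightarrow>\<^sub>L 'a) \<Rightarrow> bool" where
  "fc_value T f S \<longleftrightarrow> (\<exists>P. uniform_limit (op_spectrum T) (\<lambda>n. poly (P n)) f sequentially \<and>
    (\<lambda>n. op_poly T (P n)) \<longlonglongrightarrow> S)"

lemma fc_value_cong:
  assumes "fc_value T f S" "\<And>z. z \<in> op_spectrum T \<Longrightarrow> f z = g z"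
  shows "fc_value T g S"
proof -
  have "uniform_limit (op_spectrum T) P f sequentially \<longleftrightarrow>
      uniform_limit (op_spectrum T) P g sequentially" for P :: "nat \<Rightarrow> _"
    using assms(2) by (intro uniform_limit_cong') auto
  then show ?thesis using assms(1) unfolding fc_value_def by blast
qed

lemma poly_pointwise:
  "poly (p + q) = (\<lambda>z. poly p z + poly q z)" "poly (p - q) = (\<lambda>z. poly p z - poly q z)"
  "poly (p * q) = (\<lambda>z. poly p z * poly q z)" "poly [:c:] = (\<lambda>z. c)" "poly [:0, 1::complex:] = (\<lambda>z. z)"
  for p q :: "complex poly" and c :: complex
  by (simp_all add: fun_eq_iff)

lemma fc_value_poly: "fc_value T (poly p) (op_poly T p)"
  unfolding fc_value_def by (rule exI[of _ "\<lambda>_. p"]) (simp add: uniform_limit_const)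

lemma fc_value_const: "fc_value T (\<lambda>z. c) (scalar_op c)"
  using fc_value_poly[of T "[:c:]"] by (simp add: op_poly_const poly_pointwise)

lemma fc_value_ident: "fc_value T (\<lambda>z. z) T"
  using fc_value_poly[of T "[:0, 1:]"] by (simp add: op_poly_linear poly_pointwise)

lemma fc_value_add:
  assumes "fc_value T f S" "fc_value T g S'"
  shows "fc_value T (\<lambda>z. f z + g z) (S + S')"
proof -
  obtain P Q where "uniform_limit (op_spectrum T) (\<lambda>n. poly (P n)) f sequentially"
    "uniform_limit (op_spectrum T) (\<lambda>n. poly (Q n)) g sequentially"
    "(\<lambda>n. op_poly T (P n)) \<longlonglongrightarrow> S" "(\<lambda>n. op_poly T (Q n)) \<longlonglongrightarrow> S'"
    using assms unfolding fc_value_def by blast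
  then show ?thesis
    unfolding fc_value_def
    by (intro exI[of _ "\<lambda>n. P n + Q n"]) (auto simp: op_poly_add poly_pointwise intro!: uniform_limit_add tendsto_add)
qed

lemma fc_value_diff:
  assumes "fc_value T f S" "fc_value T g S'"
  shows "fc_value T (\<lambda>z. f z - g z) (S - S')"
proof -
  obtain P Q where "uniform_limit (op_spectrum T) (\<lambda>n. poly (P n)) f sequentially"
    "uniform_limit (op_spectrum T) (\<lambda>n. poly (Q n)) g sequentially"
    "(\<lambda>n. op_poly T (P n)) \<longlonglongrightarrow> S" "(\<lambda>n. op_poly T (Q n)) \<longlonglongrightarrow> S'"
    using assms unfolding fc_value_def by blast
  then show ?thesis
    unfolding fc_value_def
    by (intro exI[of _ "\<lambda>n. P n - Q n"]) (auto simp: op_poly_diff poly_pointwise intro!: uniform_limit_minus tendsto_diff)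
qed

context
  fixes T :: "'a::chilbert \<Rightarrow>\<^sub>L 'a"
  assumes sa: "selfadjoint_op T"
begin

lemma fc_value_bounded_ops: "fc_value T f S \<Longrightarrow> S \<in> bounded_ops"
  unfolding fc_value_def
  using bounded_ops_tendsto[OF op_poly_bounded_ops[OF selfadjoint_op_bounded_ops[OF sa]]] by blast

lemma fc_value_norm_le:
  assumes "fc_value T f S" "0 \<le> M" "\<And>z. z \<in> op_spectrum T \<Longrightarrow> cmod (f z) \<le> M"
  shows "norm S \<le> M"
proof (rule field_le_epsilon)
  fix e :: real assume "e > 0"
  obtain P where P: "uniform_limit (op_spectrum T) (\<lambda>n. poly (P n)) f sequentially"
    "(\<lambda>n. op_poly T (P n)) \<longlonglongrightarrow> S"
    using assms(1) unfolding fc_value_def by blast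
  have "\<forall>\<^sub>F n in sequentially. norm (op_poly T (P n)) \<le> M + e"
    using uniform_limitD[OF P(1) \<open>e > 0\<close>]
  proof eventually_elim
    case (elim n)
    have "cmod (poly (P n) z) \<le> M + e" if "z \<in> op_spectrum T" for z
    proof -
      have "dist (poly (P n) z) (f z) < e" using elim that by blast
      then show ?thesis
        using assms(3)[OF that] norm_triangle_sub[of "poly (P n) z" "f z"] by (simp add: dist_norm)
    qed
    then show ?case using norm_op_poly_le[OF sa, of "M + e" "P n"] assms(2) \<open>e > 0\<close> by simp
  qed
  then show "norm S \<le> M + e"
    by (rule tendsto_upperbound[OF tendsto_norm[OF P(2)]]) simp
qed

text \<open>The difference of two values is a value of the zero function, whose norm bound is
  0.\<close>

lemma fc_value_unique: "fc_value T f S \<Longrightarrow> fc_value T f S' \<Longrightarrow> S = S'"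
  using fc_value_norm_le[OF fc_value_diff, of f S f S' 0] by simp

text \<open>Applied to polynomials \<open>h n\<close>, this says that every uniformly approximating
  sequence leads to the value, not only the witness inside \<open>fc_value\<close>.\<close>

lemma fc_value_tendsto:
  assumes "\<And>n. fc_value T (h n) (X n)" "fc_value T f S"
    and "uniform_limit (op_spectrum T) h f sequentially"
  shows "X \<longlonglongrightarrow> S"
proof (rule tendstoI)
  fix e :: real assume "e > 0"
  then have "e / 2 > 0" by simp
  from uniform_limitD[OF assms(3) this]
  show "\<forall>\<^sub>F n in sequentially. dist (X n) S < e"
  proof eventually_elim
    case (elim n)
    then have "norm (X n - S) \<le> e / 2"
      using fc_value_norm_le[OF fc_value_diff[OF assms(1)[of n] assms(2)], of "e / 2"] \<open>e > 0\<close>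
      by (force simp: dist_norm)
    then show ?case using \<open>e > 0\<close> by (simp add: dist_norm)
  qed
qed

lemma op_spectrum_compact: "compact (op_spectrum T)"
  by (intro compact_op_spectrum selfadjoint_op_bounded_ops sa)

lemma fc_value_exists:
  assumes "continuous_on (op_spectrum T) f"
  shows "\<exists>S. fc_value T f S"
proof -
  obtain P where P: "uniform_limit (op_spectrum T) (\<lambda>n::nat. poly (P n)) f sequentially"
    using poly_approx[OF op_spectrum_compact op_spectrum_real[OF sa] assms] by blast
  have "Cauchy (\<lambda>n. op_poly T (P n))"
    unfolding Cauchy_def
  proof (intro allI impI)
    fix e :: real assume "e > 0"
    \<comment> \<open>Two polynomials within e/4 of f differ by at most e/2 on the spectrum; the
      remaining half makes the final inequality strict.\<close>
    then have "e / 4 > 0" by simp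
    from uniform_limitD[OF P this] obtain N where
      N: "\<And>n z. n \<ge> N \<Longrightarrow> z \<in> op_spectrum T \<Longrightarrow> dist (poly (P n) z) (f z) < e / 4"
      unfolding eventually_sequentially by blast
    have "dist (op_poly T (P m)) (op_poly T (P n)) < e" if "m \<ge> N" "n \<ge> N" for m n
    proof -
      have "cmod (poly (P m - P n) z) \<le> e / 2" if "z \<in> op_spectrum T" for z
        using N[OF \<open>m \<ge> N\<close> that] N[OF \<open>n \<ge> N\<close> that] dist_triangle2[of "poly (P m) z" "poly (P n) z" "f z"]
        by (simp add: dist_norm)
      then have "norm (op_poly T (P m - P n)) \<le> e / 2"
        using \<open>e > 0\<close> by (intro norm_op_poly_le[OF sa]) auto
      then show ?thesis using \<open>e > 0\<close> by (simp add: dist_norm op_poly_diff)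
    qed
    then show "\<exists>N. \<forall>m\<ge>N. \<forall>n\<ge>N. dist (op_poly T (P m)) (op_poly T (P n)) < e" by blast
  qed
  then obtain S where "(\<lambda>n. op_poly T (P n)) \<longlonglongrightarrow> S"
    using Cauchy_convergent convergent_def by blast
  then show ?thesis using P unfolding fc_value_def by blast
qed

lemma fc_value_mult:
  assumes "fc_value T f S" "fc_value T g S'"
    and "continuous_on (op_spectrum T) f" "continuous_on (op_spectrum T) g"
  shows "fc_value T (\<lambda>z. f z * g z) (S o\<^sub>L S')"
proof -
  obtain P Q where PQ: "uniform_limit (op_spectrum T) (\<lambda>n. poly (P n)) f sequentially"
    "uniform_limit (op_spectrum T) (\<lambda>n. poly (Q n)) g sequentially"
    "(\<lambda>n. op_poly T (P n)) \<longlonglongrightarrow> S" "(\<lambda>n. op_poly T (Q n)) \<longlonglongrightarrow> S'"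
    using assms unfolding fc_value_def by blast
  \<comment> \<open>Products of uniform limits need bounded limit functions; here compactness of the
    spectrum supplies the bounds.\<close>
  have "uniform_limit (op_spectrum T) (\<lambda>n z. poly (P n) z * poly (Q n) z) (\<lambda>z. f z * g z) sequentially"
    by (intro uniform_lim_mult PQ compact_imp_bounded compact_continuous_image op_spectrum_compact assms)
  moreover have "(\<lambda>n. op_poly T (P n) o\<^sub>L op_poly T (Q n)) \<longlonglongrightarrow> (S o\<^sub>L S')"
    by (intro bounded_bilinear.tendsto[OF bounded_bilinear_blinfun_compose] PQ)
  ultimately show ?thesis
    unfolding fc_value_def
    by (intro exI[of _ "\<lambda>n. P n * Q n"])
      (simp add: op_poly_mult[OF selfadjoint_op_bounded_ops[OF sa]] poly_pointwise)
qed

text \<open>Conjugating the coefficients of polynomials tending to f gives polynomials tending to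
  the conjugate of f, since the spectrum is real. The adjoint relation for polynomials then passes
  to the limit.\<close>

lemma fc_value_adjoint:
  assumes "fc_value T f S" "fc_value T (\<lambda>z. cnj (f z)) S'"
  shows "is_adjoint S' S"
proof -
  obtain P where P: "uniform_limit (op_spectrum T) (\<lambda>n. poly (P n)) f sequentially"
    "(\<lambda>n. op_poly T (P n)) \<longlonglongrightarrow> S"
    using assms unfolding fc_value_def by blast
  define Q where "Q n = map_poly cnj (P n)" for n
  have cnj: "poly (Q n) z = cnj (poly (P n) z)" if "z \<in> op_spectrum T" for n z
  proof -
    have "cnj z = z" using op_spectrum_real[OF sa that] by (metis complex_cnj_complex_of_real)
    then show ?thesis by (simp add: Q_def)
  qed
  have "uniform_limit (op_spectrum T) (\<lambda>n. poly (Q n)) (\<lambda>z. cnj (f z)) sequentially"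
  proof (rule uniform_limitI)
    fix e :: real assume "e > 0"
    from uniform_limitD[OF P(1) this]
    show "\<forall>\<^sub>F n in sequentially. \<forall>z\<in>op_spectrum T. dist (poly (Q n) z) (cnj (f z)) < e"
    proof eventually_elim
      case (elim n)
      then show ?case
        by (metis cnj complex_cnj_diff complex_mod_cnj dist_norm)
    qed
  qed
  then have Q: "(\<lambda>n. op_poly T (Q n)) \<longlonglongrightarrow> S'"
    by (intro fc_value_tendsto[of "\<lambda>n. poly (Q n)" _ "\<lambda>z. cnj (f z)"] fc_value_poly assms)
  have "cinner (blinfun_apply S' x) y = cinner x (blinfun_apply S y)" for x y
  proof (rule LIMSEQ_unique)
    show "(\<lambda>n. cinner (blinfun_apply (op_poly T (Q n)) x) y) \<longlonglongrightarrow> cinner (blinfun_apply S' x) y"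
      by (intro cinner.tendsto tendsto_intros Q)
    have "(\<lambda>n. cinner x (blinfun_apply (op_poly T (P n)) y)) \<longlonglongrightarrow> cinner x (blinfun_apply S y)"
      by (intro cinner.tendsto tendsto_intros P)
    then show "(\<lambda>n. cinner (blinfun_apply (op_poly T (Q n)) x) y) \<longlonglongrightarrow> cinner x (blinfun_apply S y)"
      using op_poly_is_adjoint[OF sa] by (simp add: is_adjoint_def Q_def)
  qed
  then show ?thesis by (simp add: is_adjoint_def)
qed

definition "fc_map f = (THE S. fc_value T f S)"

lemma fc_map_eq: "fc_value T f S \<Longrightarrow> fc_map f = S"
  unfolding fc_map_def using fc_value_unique by blast

lemma fc_value_fc_map: "continuous_on (op_spectrum T) f \<Longrightarrow> fc_value T f (fc_map f)"
  using fc_value_exists fc_map_eq by metis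

lemma functional_calculus_fc_map: "functional_calculus T fc_map"
  unfolding functional_calculus_def
proof (intro conjI allI impI)
  fix f g :: "complex \<Rightarrow> complex"
  assume f: "continuous_on (op_spectrum T) f" and g: "continuous_on (op_spectrum T) g"
  note F = fc_value_fc_map[OF f] and G = fc_value_fc_map[OF g]
  show "fc_map f \<in> bounded_ops" by (rule fc_value_bounded_ops[OF F])
  show "fc_map f = fc_map g" if "\<forall>z\<in>op_spectrum T. f z = g z"
    by (rule fc_map_eq, rule fc_value_cong[OF G]) (use that in simp)
  show "fc_map (\<lambda>z. f z + g z) = fc_map f + fc_map g" by (rule fc_map_eq[OF fc_value_add[OF F G]])
  show "fc_map (\<lambda>z. f z * g z) = fc_map f o\<^sub>L fc_map g" by (rule fc_map_eq[OF fc_value_mult[OF F G f g]])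
  have "continuous_on (op_spectrum T) (\<lambda>z. cnj (f z))" by (intro continuous_intros f)
  from fc_value_adjoint[OF F fc_value_fc_map[OF this]]
  show "is_adjoint (fc_map (\<lambda>z. cnj (f z))) (fc_map f)" .
next
  show "fc_map (\<lambda>z. c) = scalar_op c" for c by (rule fc_map_eq[OF fc_value_const])
  show "fc_map (\<lambda>z. z) = T" by (rule fc_map_eq[OF fc_value_ident])
qed

text \<open>On polynomials \<Phi> is forced by its algebraic properties. Contractivity follows from
  the star property alone, and then polynomial approximation determines \<Phi> on every continuous
  function.\<close>

lemma functional_calculus_unique:
  assumes fc: "functional_calculus T \<Phi>" and f: "continuous_on (op_spectrum T) f"
  shows "fc_value T f (\<Phi> f)"
proof -
  let ?C = "\<lambda>f. continuous_on (op_spectrum T) (f :: complex \<Rightarrow> complex)"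
  have add: "\<Phi> (\<lambda>z. g z + h z) = \<Phi> g + \<Phi> h"
    and mult: "\<Phi> (\<lambda>z. g z * h z) = \<Phi> g o\<^sub>L \<Phi> h"
    and adj: "is_adjoint (\<Phi> (\<lambda>z. cnj (g z))) (\<Phi> g)" if "?C g" "?C h" for g h
    using fc that unfolding functional_calculus_def by blast+
  have cong: "\<Phi> g = \<Phi> h" if "?C g" "?C h" "\<And>z. z \<in> op_spectrum T \<Longrightarrow> g z = h z" for g h
    using fc that unfolding functional_calculus_def by blast
  have const: "\<Phi> (\<lambda>z. c) = scalar_op c" and ident: "\<Phi> (\<lambda>z. z) = T" for c
    using fc unfolding functional_calculus_def by blast+
  have poly: "\<Phi> (poly p) = op_poly T p" for p
  proof (induction p)
    case 0
    then show ?case using const[of 0] by (simp add: poly_0[abs_def])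
  next
    case (pCons a p)
    have "poly (pCons a p) = (\<lambda>z. a + z * poly p z)" by (simp add: fun_eq_iff)
    then have "\<Phi> (poly (pCons a p)) = \<Phi> (\<lambda>z. a) + (\<Phi> (\<lambda>z. z) o\<^sub>L \<Phi> (poly p))"
      by (simp add: add mult continuous_intros)
    then show ?case by (simp only: const ident pCons op_poly_pCons)
  qed
  have norm_le: "norm (\<Phi> h) \<le> M" if h: "?C h" and M: "0 \<le> M"
    and le: "\<And>z. z \<in> op_spectrum T \<Longrightarrow> cmod (h z) \<le> M" for h M
  proof (rule norm_blinfun_bound[OF M])
    fix x
    \<comment> \<open>Complements \<open>h\<close> to |h|^2 + |k|^2 = M^2 on the spectrum, so
      |\<Phi>(h) x|^2 + |\<Phi>(k) x|^2 = M^2 |x|^2, and dropping the second square bounds the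
      first.\<close>
    define k where "k z = complex_of_real (sqrt (M\<^sup>2 - (cmod (h z))\<^sup>2))" for z
    have k: "?C k" unfolding k_def by (intro continuous_intros h)
    have nrm: "complex_of_real ((norm (blinfun_apply (\<Phi> g) x))\<^sup>2)
        = cinner x (blinfun_apply (\<Phi> (\<lambda>z. cnj (g z) * g z)) x)" if "?C g" for g
      using norm_apply_sq_adjoint[OF adj[OF that that], of x]
      by (subst mult) (auto intro!: continuous_intros that)
    have "\<Phi> (\<lambda>z. cnj (h z) * h z) + \<Phi> (\<lambda>z. cnj (k z) * k z)
        = \<Phi> (\<lambda>z. cnj (h z) * h z + cnj (k z) * k z)"
      by (subst add) (auto intro!: continuous_intros h k)
    also have "\<dots> = \<Phi> (\<lambda>z. complex_of_real (M\<^sup>2))"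
    proof (rule cong)
      fix z assume "z \<in> op_spectrum T"
      then have "(cmod (h z))\<^sup>2 \<le> M\<^sup>2" using le by (simp add: power_mono)
      then have "cnj (k z) * k z = complex_of_real (M\<^sup>2 - (cmod (h z))\<^sup>2)"
        by (simp add: k_def flip: of_real_mult)
      moreover have "cnj (h z) * h z = complex_of_real ((cmod (h z))\<^sup>2)"
        by (metis complex_norm_square mult.commute)
      ultimately show "cnj (h z) * h z + cnj (k z) * k z = complex_of_real (M\<^sup>2)"
        by (simp add: flip: of_real_add)
    qed (auto intro!: continuous_intros h k)
    finally have "complex_of_real ((norm (blinfun_apply (\<Phi> h) x))\<^sup>2)
        + complex_of_real ((norm (blinfun_apply (\<Phi> k) x))\<^sup>2) = cinner x (M\<^sup>2 *\<^sub>R x)"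
      by (simp only: nrm[OF h] nrm[OF k] const cinner_add_right[symmetric] blinfun.add_left[symmetric]
          scalar_op_of_real blinfun.scaleR_left id_blinfun.rep_eq id_apply)
    then have "(norm (blinfun_apply (\<Phi> h) x))\<^sup>2 + (norm (blinfun_apply (\<Phi> k) x))\<^sup>2 = M\<^sup>2 * (norm x)\<^sup>2"
      by (simp add: cinner_scaleR_right cinner_self scaleR_conv_of_real
          flip: of_real_mult of_real_add of_real_power)
    then have "(norm (blinfun_apply (\<Phi> h) x))\<^sup>2 \<le> (M * norm x)\<^sup>2"
      by (simp add: power_mult_distrib) (metis le_add_same_cancel1 zero_le_power2)
    then show "norm (blinfun_apply (\<Phi> h) x) \<le> M * norm x"
      by (rule power2_le_imp_le) (simp add: M)
  qed
  obtain P where P: "uniform_limit (op_spectrum T) (\<lambda>n::nat. poly (P n)) f sequentially"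
    using poly_approx[OF op_spectrum_compact op_spectrum_real[OF sa] f] by blast
  have "(\<lambda>n. op_poly T (P n)) \<longlonglongrightarrow> \<Phi> f"
  proof (rule tendstoI)
    fix e :: real assume "e > 0"
    then have "e / 2 > 0" by simp
    from uniform_limitD[OF P this]
    show "\<forall>\<^sub>F n in sequentially. dist (op_poly T (P n)) (\<Phi> f) < e"
    proof eventually_elim
      case (elim n)
      have cont: "?C (\<lambda>z. poly (P n) z - f z)" by (intro continuous_intros f)
      have "\<Phi> (poly (P n)) = \<Phi> (\<lambda>z. (poly (P n) z - f z) + f z)" by simp
      also have "\<dots> = \<Phi> (\<lambda>z. poly (P n) z - f z) + \<Phi> f" by (rule add[OF cont f])
      finally have "op_poly T (P n) - \<Phi> f = \<Phi> (\<lambda>z. poly (P n) z - f z)" by (simp add: poly)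
      moreover have "norm (\<Phi> (\<lambda>z. poly (P n) z - f z)) \<le> e / 2"
        using elim \<open>e > 0\<close> by (intro norm_le[OF cont]) (auto simp: dist_norm less_imp_le)
      ultimately show ?case using \<open>e > 0\<close> by (simp add: dist_norm)
    qed
  qed
  then show ?thesis using P unfolding fc_value_def by blast
qed

text \<open>Resolves the definite description: \<open>fc_map\<close> provides a calculus, and any
  other gives the same operator. From here on \<open>cfc\<close> is handled through
  \<open>fc_value\<close> only.\<close>

lemma fc_value_cfc:
  assumes "continuous_on (Re ` op_spectrum T) f"
  shows "fc_value T (\<lambda>z. complex_of_real (f (Re z))) (cfc f T)"
proof -
  let ?f = "\<lambda>z. complex_of_real (f (Re z))"
  have cont: "continuous_on (op_spectrum T) ?f"
    by (intro continuous_intros continuous_on_compose2[OF assms]) auto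
  have "cfc f T = fc_map ?f"
    unfolding cfc_def
    by (rule the_equality)
      (use functional_calculus_fc_map functional_calculus_unique cont fc_map_eq in \<open>metis\<close>)+
  then show ?thesis using fc_value_fc_map[OF cont] by simp
qed

end

section \<open>Functional calculus of positive invertible operators\<close>

lemma positive_invertible_opsD:
  assumes "T \<in> positive_invertible_ops"
  shows "psd_op T" "invertible_op T" "selfadjoint_op T" "T \<in> bounded_ops"
  using assms by (auto simp: positive_invertible_ops_def psd_op_def selfadjoint_op_def)

text \<open>The form is bounded below by some c > 0, so T - r is invertible for every r < c. Hence
  continuity on \<open>{0<..}\<close> is all that is required of functions applied to T.\<close>

lemma positive_invertible_op_spectrum:
  fixes T :: "'a::chilbert \<Rightarrow>\<^sub>L 'a"
  assumes "T \<in> positive_invertible_ops" "z \<in> op_spectrum T"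
  shows "Re z > 0"
proof -
  note T = positive_invertible_opsD[OF assms(1)]
  obtain c where c: "c > 0" "\<And>x. c * (norm x)\<^sup>2 \<le> Re (cinner x (blinfun_apply T x))"
    by (rule invertible_psd_op_bounded_below[OF T(1,2)]) blast
  have "invertible_op (T - Re z *\<^sub>R id_blinfun)" if "Re z < c"
  proof (rule invertible_op_if_bounded_below)
    show "selfadjoint_op (T - Re z *\<^sub>R id_blinfun)"
      by (intro selfadjoint_op_diff selfadjoint_op_scaleR selfadjoint_op_id T)
    show "c - Re z > 0" using that by simp
    show "(c - Re z) * (norm x)\<^sup>2 \<le> Re (cinner x (blinfun_apply (T - Re z *\<^sub>R id_blinfun) x))" for x
      using c(2)[of x]
      by (simp add: blinfun.diff_left blinfun.scaleR_left cinner.diff_right cinner_scaleR_right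
          left_diff_distrib) (simp add: cinner_self del: of_real_power)
  qed
  moreover have "\<not> invertible_op (T - Re z *\<^sub>R id_blinfun)"
    using assms(2) op_spectrum_real[OF T(3) assms(2)]
    by (metis (mono_tags) mem_Collect_eq op_spectrum_def scalar_op_of_real)
  ultimately show ?thesis using c(1) by linarith
qed

lemma continuous_on_cfc_lift:
  assumes "continuous_on {0<..} f" "\<And>z. z \<in> K \<Longrightarrow> Re z > 0"
  shows "continuous_on K (\<lambda>z. complex_of_real (f (Re z)))"
  by (intro continuous_intros continuous_on_compose2[OF assms(1)]) (use assms(2) in auto)

lemma fc_value_cfc_pos:
  assumes "T \<in> positive_invertible_ops" "continuous_on {0<..} f"
  shows "fc_value T (\<lambda>z. complex_of_real (f (Re z))) (cfc f T)"
  by (intro fc_value_cfc positive_invertible_opsD continuous_on_subset[OF assms(2)] assms)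
    (auto intro: positive_invertible_op_spectrum[OF assms(1)])

text \<open>The polynomial case of the composition rule, from which the general one follows by
  approximation.\<close>

lemma fc_value_op_poly:
  assumes sa: "selfadjoint_op T" and f: "fc_value T f S" "continuous_on (op_spectrum T) f"
  shows "fc_value T (\<lambda>z. poly p (f z)) (op_poly S p)"
proof (induction p)
  case 0
  then show ?case using fc_value_const[of T 0] by simp
next
  case (pCons a p)
  have "continuous_on (op_spectrum T) (\<lambda>z. poly p (f z))" by (intro continuous_intros f)
  from fc_value_add[OF fc_value_const[of T a] fc_value_mult[OF sa f(1) pCons(2) f(2) this]]
  show ?case by (simp add: op_poly_pCons)
qed

text \<open>Inner factors W V cancel in each power, and V commutes with scalars because it is
  complex-linear.\<close>

lemma op_poly_similar:
  assumes "V \<in> bounded_ops" "V o\<^sub>L W = id_blinfun" "W o\<^sub>L V = id_blinfun"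
  shows "op_poly (V o\<^sub>L T o\<^sub>L W) p = V o\<^sub>L op_poly T p o\<^sub>L W"
proof (induction p)
  case (pCons a p)
  have WV: "W o\<^sub>L (V o\<^sub>L U) = U" for U using assms(3) by (metis compose_assoc compose_id(2))
  have "V o\<^sub>L scalar_op a o\<^sub>L W = scalar_op a"
    using assms(1,2) by (simp add: scalar_op_commute compose_assoc)
  then show ?case
    unfolding op_poly_pCons pCons(2) by (simp add: compose_distribs compose_assoc WV)
qed (simp add: compose_distribs)

context
  fixes T :: "'a::chilbert \<Rightarrow>\<^sub>L 'a"
  assumes T: "T \<in> positive_invertible_ops"
begin

lemma cfc_eqI:
  assumes "continuous_on {0<..} f" "fc_value T (\<lambda>z. complex_of_real (f (Re z))) S"
  shows "cfc f T = S"
  by (rule fc_value_unique[OF positive_invertible_opsD(3)[OF T] fc_value_cfc_pos[OF T assms(1)] assms(2)])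

lemma cfc_cong:
  assumes "continuous_on {0<..} g" "\<And>x. x > 0 \<Longrightarrow> f x = g x"
  shows "cfc f T = cfc g T"
proof (rule cfc_eqI)
  show "continuous_on {0<..} f"
    using continuous_on_cong[of "{0<..}" "{0<..}" f g] assms by simp
  show "fc_value T (\<lambda>z. complex_of_real (f (Re z))) (cfc g T)"
    by (rule fc_value_cong[OF fc_value_cfc_pos[OF T assms(1)]])
      (simp add: assms(2) positive_invertible_op_spectrum[OF T])
qed

lemma cfc_const: "cfc (\<lambda>x. c) T = c *\<^sub>R id_blinfun"
  by (rule cfc_eqI) (use fc_value_const[of T "complex_of_real c"] in \<open>auto simp: scalar_op_of_real\<close>)

lemma cfc_ident: "cfc (\<lambda>x. x) T = T"
proof (rule cfc_eqI)
  show "fc_value T (\<lambda>z. complex_of_real (Re z)) T"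
    by (rule fc_value_cong[OF fc_value_ident])
      (rule op_spectrum_real[OF positive_invertible_opsD(3)[OF T]])
qed (rule continuous_on_id)

lemma cfc_add:
  assumes "continuous_on {0<..} f" "continuous_on {0<..} g"
  shows "cfc (\<lambda>x. f x + g x) T = cfc f T + cfc g T"
  by (rule cfc_eqI)
    (use fc_value_add[OF fc_value_cfc_pos[OF T assms(1)] fc_value_cfc_pos[OF T assms(2)]] in
      \<open>auto intro!: continuous_intros assms\<close>)

lemma cfc_diff:
  assumes "continuous_on {0<..} f" "continuous_on {0<..} g"
  shows "cfc (\<lambda>x. f x - g x) T = cfc f T - cfc g T"
  by (rule cfc_eqI)
    (use fc_value_diff[OF fc_value_cfc_pos[OF T assms(1)] fc_value_cfc_pos[OF T assms(2)]] in
      \<open>auto intro!: continuous_intros assms\<close>)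

lemma cfc_mult:
  assumes "continuous_on {0<..} f" "continuous_on {0<..} g"
  shows "cfc (\<lambda>x. f x * g x) T = cfc f T o\<^sub>L cfc g T"
proof (rule cfc_eqI)
  have "continuous_on (op_spectrum T) (\<lambda>z. complex_of_real (f (Re z)))"
    "continuous_on (op_spectrum T) (\<lambda>z. complex_of_real (g (Re z)))"
    by (intro continuous_on_cfc_lift assms positive_invertible_op_spectrum[OF T]; assumption)+
  from fc_value_mult[OF positive_invertible_opsD(3)[OF T] fc_value_cfc_pos[OF T assms(1)]
      fc_value_cfc_pos[OF T assms(2)] this]
  show "fc_value T (\<lambda>z. complex_of_real (f (Re z) * g (Re z))) (cfc f T o\<^sub>L cfc g T)" by simp
qed (intro continuous_intros assms)

lemma cfc_scaleR:
  assumes "continuous_on {0<..} f"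
  shows "cfc (\<lambda>x. c * f x) T = c *\<^sub>R cfc f T"
  using cfc_mult[of "\<lambda>x. c" f] assms by (simp add: cfc_const compose_distribs)

lemma selfadjoint_cfc:
  assumes "continuous_on {0<..} f"
  shows "selfadjoint_op (cfc f T)"
  using fc_value_bounded_ops[OF positive_invertible_opsD(3)[OF T] fc_value_cfc_pos[OF T assms]]
    fc_value_adjoint[OF positive_invertible_opsD(3)[OF T] fc_value_cfc_pos[OF T assms], of "cfc f T"]
    fc_value_cfc_pos[OF T assms]
  by (simp add: selfadjoint_op_def)

text \<open>The form of f(T) at x is |sqrt(f)(T) x|^2.\<close>

lemma psd_cfc:
  assumes "continuous_on {0<..} f" "\<And>x. x > 0 \<Longrightarrow> f x \<ge> 0"
  shows "psd_op (cfc f T)"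
proof -
  let ?g = "\<lambda>x. sqrt (f x)"
  have g: "continuous_on {0<..} ?g" by (intro continuous_intros assms)
  have "cfc f T = cfc (\<lambda>x. ?g x * ?g x) T"
    by (rule cfc_cong) (auto simp: assms(2) intro!: continuous_intros assms(1))
  then have sq: "cfc f T = cfc ?g T o\<^sub>L cfc ?g T" by (simp only: cfc_mult[OF g g])
  have "0 \<le> Re (cinner x (blinfun_apply (cfc f T) x))" for x
    by (simp add: sq selfadjoint_opD[OF selfadjoint_cfc[OF g], symmetric] cinner_self)
  then show ?thesis by (simp add: psd_op_iff selfadjoint_cfc assms)
qed

lemma positive_invertible_cfc:
  assumes f: "continuous_on {0<..} f" and pos: "\<And>x. x > 0 \<Longrightarrow> f x > 0"
  shows "cfc f T \<in> positive_invertible_ops"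
proof -
  let ?g = "\<lambda>x. 1 / f x"
  have g: "continuous_on {0<..} ?g"
    by (intro continuous_intros f) (use pos in force)
  have "cfc (\<lambda>x. f x * ?g x) T = cfc (\<lambda>x. 1) T" "cfc (\<lambda>x. ?g x * f x) T = cfc (\<lambda>x. 1) T"
    by (rule cfc_cong; use pos in force)+
  then have "cfc f T o\<^sub>L cfc ?g T = id_blinfun" "cfc ?g T o\<^sub>L cfc f T = id_blinfun"
    by (simp_all only: cfc_mult[OF f g] cfc_mult[OF g f] cfc_const scaleR_one)
  then have "invertible_op (cfc f T)"
    using invertible_opI[OF selfadjoint_op_bounded_ops[OF selfadjoint_cfc[OF f]]] by blast
  moreover have "psd_op (cfc f T)" using psd_cfc[OF f] pos by (simp add: less_imp_le)
  ultimately show ?thesis by (simp add: positive_invertible_ops_def)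
qed

text \<open>Polynomials are chosen to approximate F simultaneously on the spectrum of S = h(T) and
  on the image of the spectrum of T under h, which avoids comparing these two sets. Along them p(S)
  tends to F(S) and to (F o h)(T).\<close>

lemma cfc_compose:
  assumes h: "continuous_on {0<..} h" and pos: "\<And>x. x > 0 \<Longrightarrow> h x > 0"
    and F: "continuous_on {0<..} F"
  shows "cfc F (cfc h T) = cfc (\<lambda>x. F (h x)) T"
proof -
  define S where "S = cfc h T"
  note sa = positive_invertible_opsD(3)
  have S: "S \<in> positive_invertible_ops" unfolding S_def by (rule positive_invertible_cfc[OF h pos])
  let ?h = "\<lambda>z. complex_of_real (h (Re z))" and ?F = "\<lambda>z. complex_of_real (F (Re z))"
  define K where "K = op_spectrum S \<union> ?h ` op_spectrum T"
  have ch: "continuous_on (op_spectrum T) ?h"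
    by (intro continuous_on_cfc_lift h positive_invertible_op_spectrum[OF T])
  have "compact K" unfolding K_def
    by (intro compact_Un compact_continuous_image ch op_spectrum_compact sa S T)
  moreover have "z = complex_of_real (Re z)" if "z \<in> K" for z
    using that op_spectrum_real[OF sa[OF S]] by (auto simp: K_def)
  moreover have "continuous_on K ?F"
    by (rule continuous_on_cfc_lift[OF F])
      (use positive_invertible_op_spectrum S T pos in \<open>auto simp: K_def\<close>)
  ultimately obtain P where P: "uniform_limit K (\<lambda>n::nat. poly (P n)) ?F sequentially"
    using poly_approx by blast
  have Fh: "continuous_on {0<..} (\<lambda>x. F (h x))"
    by (intro continuous_on_compose2[OF F h]) (use pos in auto)
  have "(\<lambda>n. op_poly S (P n)) \<longlonglongrightarrow> cfc (\<lambda>x. F (h x)) T"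
  proof (rule fc_value_tendsto[OF sa[OF T]])
    show "fc_value T (\<lambda>z. poly (P n) (?h z)) (op_poly S (P n))" for n
      unfolding S_def by (intro fc_value_op_poly fc_value_cfc_pos sa T h ch)
    show "fc_value T (\<lambda>z. complex_of_real (F (h (Re z)))) (cfc (\<lambda>x. F (h x)) T)"
      by (rule fc_value_cfc_pos[OF T Fh])
    show "uniform_limit (op_spectrum T) (\<lambda>n z. poly (P n) (?h z))
        (\<lambda>z. complex_of_real (F (h (Re z)))) sequentially"
    proof -
      have "?h \<in> op_spectrum T \<rightarrow> K" by (auto simp: K_def)
      from uniform_limit_compose'[OF P this] show ?thesis by simp
    qed
  qed
  moreover have "uniform_limit (op_spectrum S) (\<lambda>n. poly (P n)) ?F sequentially"
    by (rule uniform_limit_on_subset[OF P]) (simp add: K_def)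
  ultimately have "fc_value S ?F (cfc (\<lambda>x. F (h x)) T)" unfolding fc_value_def by blast
  then have "cfc F S = cfc (\<lambda>x. F (h x)) T"
    by (rule fc_value_unique[OF sa[OF S] fc_value_cfc_pos[OF S F]])
  then show ?thesis by (simp add: S_def)
qed

text \<open>The same device: one polynomial sequence approximates F on both spectra, and similarity
  is known for polynomials.\<close>

lemma cfc_similar:
  assumes VW: "V \<in> bounded_ops" "V o\<^sub>L W = id_blinfun" "W o\<^sub>L V = id_blinfun"
    and S: "V o\<^sub>L T o\<^sub>L W \<in> positive_invertible_ops" and F: "continuous_on {0<..} F"
  shows "cfc F (V o\<^sub>L T o\<^sub>L W) = V o\<^sub>L cfc F T o\<^sub>L W"
proof -
  define S where "S = V o\<^sub>L T o\<^sub>L W"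
  note sa = positive_invertible_opsD(3)
  have S: "S \<in> positive_invertible_ops" unfolding S_def by (rule S)
  let ?F = "\<lambda>z. complex_of_real (F (Re z))"
  define K where "K = op_spectrum S \<union> op_spectrum T"
  have "compact K" unfolding K_def by (intro compact_Un op_spectrum_compact sa S T)
  moreover have "z = complex_of_real (Re z)" if "z \<in> K" for z
    using that op_spectrum_real sa S T by (metis K_def Un_iff)
  moreover have "continuous_on K ?F"
    by (rule continuous_on_cfc_lift[OF F])
      (use positive_invertible_op_spectrum S T in \<open>auto simp: K_def\<close>)
  ultimately obtain P where P: "uniform_limit K (\<lambda>n::nat. poly (P n)) ?F sequentially"
    using poly_approx by blast
  have "(\<lambda>n. op_poly T (P n)) \<longlonglongrightarrow> cfc F T"
    by (rule fc_value_tendsto[OF sa[OF T] fc_value_poly fc_value_cfc_pos[OF T F]])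
      (rule uniform_limit_on_subset[OF P], simp add: K_def)
  then have "(\<lambda>n. op_poly S (P n)) \<longlonglongrightarrow> (V o\<^sub>L cfc F T o\<^sub>L W)"
    unfolding S_def op_poly_similar[OF VW]
    by (intro bounded_bilinear.tendsto[OF bounded_bilinear_blinfun_compose] tendsto_const)
  moreover have "uniform_limit (op_spectrum S) (\<lambda>n. poly (P n)) ?F sequentially"
    by (rule uniform_limit_on_subset[OF P]) (simp add: K_def)
  ultimately have "fc_value S ?F (V o\<^sub>L cfc F T o\<^sub>L W)" unfolding fc_value_def by blast
  then have "cfc F S = V o\<^sub>L cfc F T o\<^sub>L W"
    by (rule fc_value_unique[OF sa[OF S] fc_value_cfc_pos[OF S F]])
  then show ?thesis by (simp add: S_def)
qed

lemma op_powr_positive_invertible: "op_powr T p \<in> positive_invertible_ops"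
  unfolding op_powr_def by (rule positive_invertible_cfc) (auto intro!: continuous_intros)

lemma op_powr_compose: "op_powr T p o\<^sub>L op_powr T q = op_powr T (p + q)"
  unfolding op_powr_def
  by (subst cfc_mult[symmetric]) (auto simp: powr_add intro!: continuous_intros cfc_cong)

lemma op_powr_0: "op_powr T 0 = id_blinfun"
  unfolding op_powr_def using cfc_cong[of "\<lambda>x. 1" "\<lambda>x. x powr 0"] by (simp add: cfc_const)

lemma op_powr_1: "op_powr T 1 = T"
  unfolding op_powr_def using cfc_cong[of "\<lambda>x. x" "\<lambda>x. x powr 1"] by (simp add: cfc_ident)

end

section \<open>Congruences, order and operator means\<close>

lemma positive_invertible_sandwich:
  assumes "C \<in> positive_invertible_ops" "T \<in> positive_invertible_ops"
  shows "C o\<^sub>L T o\<^sub>L C \<in> positive_invertible_ops"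
proof -
  note C = positive_invertible_opsD[OF assms(1)] and T = positive_invertible_opsD[OF assms(2)]
  have "0 \<le> Re (cinner x (blinfun_apply (C o\<^sub>L T o\<^sub>L C) x))" for x
    using T(1) by (simp add: psd_op_iff selfadjoint_opD[OF C(3), symmetric])
  then show ?thesis
    by (simp add: positive_invertible_ops_def psd_op_iff selfadjoint_op_sandwich invertible_op_compose C T)
qed

lemma loewner_le_sandwich:
  assumes "selfadjoint_op C" "S \<preceq> T"
  shows "C o\<^sub>L S o\<^sub>L C \<preceq> C o\<^sub>L T o\<^sub>L C"
proof -
  have "(C o\<^sub>L T o\<^sub>L C) - (C o\<^sub>L S o\<^sub>L C) = C o\<^sub>L (T - S) o\<^sub>L C" by (simp add: compose_distribs)
  moreover have "psd_op (C o\<^sub>L (T - S) o\<^sub>L C)"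
    using assms by (simp add: loewner_le_def psd_op_iff selfadjoint_op_sandwich
        selfadjoint_opD[OF assms(1), symmetric])
  ultimately show ?thesis using assms by (simp add: loewner_le_def selfadjoint_op_sandwich)
qed

lemma cfc_mono:
  assumes "T \<in> positive_invertible_ops" "continuous_on {0<..} f" "continuous_on {0<..} g"
    and "\<And>x. x > 0 \<Longrightarrow> f x \<le> g x"
  shows "cfc f T \<preceq> cfc g T"
proof -
  have "psd_op (cfc (\<lambda>x. g x - f x) T)"
    by (rule psd_cfc[OF assms(1)]) (auto intro!: continuous_intros assms simp: assms(4))
  then show ?thesis by (simp add: loewner_le_def selfadjoint_cfc cfc_diff assms)
qed

text \<open>For \<open>W = P\<^sup>1\<^sup>/\<^sup>2 C (C P C)\<^sup>-\<^sup>1\<^sup>/\<^sup>2\<close>, which is unitary, the operator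
  \<open>P\<^sup>-\<^sup>1\<^sup>/\<^sup>2 Q P\<^sup>-\<^sup>1\<^sup>/\<^sup>2\<close> is similar to the corresponding one for \<open>C P C\<close> and \<open>C Q C\<close>.\<close>

lemma op_mean_congruence:
  fixes C P Q :: "'a::chilbert \<Rightarrow>\<^sub>L 'a"
  assumes C: "C \<in> positive_invertible_ops" and P: "P \<in> positive_invertible_ops"
    and Q: "Q \<in> positive_invertible_ops" and F: "continuous_on {0<..} F"
  shows "op_mean F (C o\<^sub>L P o\<^sub>L C) (C o\<^sub>L Q o\<^sub>L C) = C o\<^sub>L op_mean F P Q o\<^sub>L C"
proof -
  define P1 P2 where "P1 = op_powr P (1/2)" and "P2 = op_powr P (-1/2)"
  define R where "R = C o\<^sub>L P o\<^sub>L C"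
  define E D where "E = op_powr R (1/2)" and "D = op_powr R (-1/2)"
  have R: "R \<in> positive_invertible_ops" unfolding R_def by (rule positive_invertible_sandwich[OF C P])
  have half: "P1 o\<^sub>L P1 = P" "P1 o\<^sub>L P2 = id_blinfun" "P2 o\<^sub>L P1 = id_blinfun"
    "E o\<^sub>L E = R" "E o\<^sub>L D = id_blinfun" "D o\<^sub>L E = id_blinfun"
    by (simp_all add: P1_def P2_def E_def D_def op_powr_compose P R op_powr_0 op_powr_1)
  obtain C' where C': "C' o\<^sub>L C = id_blinfun" "C o\<^sub>L C' = id_blinfun"
    using positive_invertible_opsD(2)[OF C] unfolding invertible_op_def by blast
  have cancel: "X o\<^sub>L (Y o\<^sub>L Z) = Z" if "X o\<^sub>L Y = id_blinfun" for X Y Z :: "'a \<Rightarrow>\<^sub>L 'a"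
    using that by (metis compose_assoc compose_id(2))
  note cancels = half(2,3,5,6)[THEN cancel] C'[THEN cancel]
  define V W where "V = D o\<^sub>L C o\<^sub>L P1" and "W = P1 o\<^sub>L C o\<^sub>L D"
  have pos: "P1 \<in> positive_invertible_ops" "P2 \<in> positive_invertible_ops"
    "E \<in> positive_invertible_ops" "D \<in> positive_invertible_ops"
    by (simp_all add: P1_def P2_def E_def D_def op_powr_positive_invertible P R)
  have V: "V \<in> bounded_ops"
    unfolding V_def by (intro bounded_ops_compose positive_invertible_opsD(4) pos C)
  have "V o\<^sub>L W = D o\<^sub>L (C o\<^sub>L (P1 o\<^sub>L P1) o\<^sub>L C) o\<^sub>L D"
    by (simp only: V_def W_def compose_assoc)
  also have "\<dots> = (D o\<^sub>L E) o\<^sub>L (E o\<^sub>L D)" unfolding half(1) R_def[symmetric] half(4)[symmetric] by (simp only: compose_assoc)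
  also have "\<dots> = id_blinfun" by (simp add: half)
  finally have VW: "V o\<^sub>L W = id_blinfun" .
  \<comment> \<open>An explicit right inverse of \<open>W\<close>. As \<open>V\<close> is a left
    inverse factor with V W = 1, it equals \<open>W'\<close>, which yields W V = 1.\<close>
  define W' where "W' = E o\<^sub>L C' o\<^sub>L P2"
  have WW': "W o\<^sub>L W' = id_blinfun" by (simp add: W_def W'_def compose_assoc cancels half)
  have "V = V o\<^sub>L (W o\<^sub>L W')" by (simp add: WW')
  also have "\<dots> = W'" by (rule cancel[OF VW])
  finally have WV: "W o\<^sub>L V = id_blinfun" using WW' by simp
  define Z where "Z = P2 o\<^sub>L Q o\<^sub>L P2"
  have Z: "Z \<in> positive_invertible_ops" unfolding Z_def by (rule positive_invertible_sandwich[OF pos(2) Q])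
  have sim: "D o\<^sub>L (C o\<^sub>L Q o\<^sub>L C) o\<^sub>L D = V o\<^sub>L Z o\<^sub>L W"
    by (simp add: V_def W_def Z_def compose_assoc cancels)
  then have "V o\<^sub>L Z o\<^sub>L W \<in> positive_invertible_ops"
    by (metis positive_invertible_sandwich pos(4) C Q)
  from cfc_similar[OF Z V VW WV this F]
  have "op_mean F R (C o\<^sub>L Q o\<^sub>L C) = E o\<^sub>L (V o\<^sub>L cfc F Z o\<^sub>L W) o\<^sub>L E"
    by (simp only: op_mean_def E_def[symmetric] D_def[symmetric] sim)
  \<comment> \<open>The outer factors collapse: E V = C P1 and W E = P1 C.\<close>
  also have "\<dots> = C o\<^sub>L (P1 o\<^sub>L cfc F Z o\<^sub>L P1) o\<^sub>L C"
    by (simp add: V_def W_def compose_assoc cancels half)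
  finally show ?thesis by (simp only: R_def op_mean_def P1_def[symmetric] P2_def[symmetric] Z_def[symmetric])
qed

text \<open>Everything here is a function of the one operator T, so the factors commute and the
  powers of f combine. The function f F(g/f) is the perspective of F, that is, the homogeneous
  two-variable mean evaluated at f and g.\<close>

lemma op_mean_cfc:
  assumes T: "T \<in> positive_invertible_ops" and F: "continuous_on {0<..} F"
    and f: "continuous_on {0<..} f" "\<And>x. x > 0 \<Longrightarrow> f x > 0"
    and g: "continuous_on {0<..} g" "\<And>x. x > 0 \<Longrightarrow> g x > 0"
  shows "op_mean F (cfc f T) (cfc g T) = cfc (\<lambda>x. f x * F (g x / f x)) T"
proof -
  have powr: "continuous_on {0<..} (\<lambda>x. f x powr p)" for p
    by (intro continuous_intros f) (use f(2) in force)
  have pow: "op_powr (cfc f T) p = cfc (\<lambda>x. f x powr p) T" for p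
    unfolding op_powr_def by (rule cfc_compose[OF T f]) (auto intro!: continuous_intros)
  have gf: "continuous_on {0<..} (\<lambda>x. g x / f x)"
    by (intro continuous_intros f g) (use f(2) in force)
  have Fgf: "continuous_on {0<..} (\<lambda>x. F (g x / f x))"
    by (intro continuous_on_compose2[OF F gf]) (use f g in auto)
  have "op_powr (cfc f T) (-1/2) o\<^sub>L cfc g T o\<^sub>L op_powr (cfc f T) (-1/2)
      = cfc (\<lambda>x. f x powr (-1/2) * g x * f x powr (-1/2)) T"
    by (simp add: pow cfc_mult[OF T] powr g continuous_on_mult)
  also have "\<dots> = cfc (\<lambda>x. g x / f x) T"
  proof (rule cfc_cong[OF T gf])
    fix x :: real assume "x > 0"
    then have "f x powr (-1/2) * f x powr (-1/2) = 1 / f x"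
      using f(2)[of x] by (simp add: powr_add[symmetric] powr_minus_divide)
    then show "f x powr (-1/2) * g x * f x powr (-1/2) = g x / f x"
      by (metis mult.assoc mult.commute mult_1 times_divide_eq_left)
  qed
  finally have "op_mean F (cfc f T) (cfc g T)
      = cfc (\<lambda>x. f x powr (1/2)) T o\<^sub>L cfc F (cfc (\<lambda>x. g x / f x) T) o\<^sub>L cfc (\<lambda>x. f x powr (1/2)) T"
    by (simp add: op_mean_def pow)
  also have "cfc F (cfc (\<lambda>x. g x / f x) T) = cfc (\<lambda>x. F (g x / f x)) T"
    by (rule cfc_compose[OF T gf _ F]) (use f g in auto)
  also have "cfc (\<lambda>x. f x powr (1/2)) T o\<^sub>L cfc (\<lambda>x. F (g x / f x)) T o\<^sub>L cfc (\<lambda>x. f x powr (1/2)) T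
      = cfc (\<lambda>x. f x powr (1/2) * F (g x / f x) * f x powr (1/2)) T"
    by (simp add: cfc_mult[OF T] powr Fgf continuous_on_mult)
  also have "\<dots> = cfc (\<lambda>x. f x * F (g x / f x)) T"
  proof (rule cfc_cong[OF T])
    show "continuous_on {0<..} (\<lambda>x. f x * F (g x / f x))" by (intro continuous_intros f Fgf)
    fix x :: real assume "x > 0"
    then have "f x powr (1/2) * f x powr (1/2) = f x"
      using f(2)[of x] by (simp add: powr_add[symmetric])
    then show "f x powr (1/2) * F (g x / f x) * f x powr (1/2) = f x * F (g x / f x)"
      by (metis mult.assoc mult.commute)
  qed
  finally show ?thesis .
qed

section \<open>Scalar means\<close>

definition logmean1 :: "real \<Rightarrow> real" where
  "logmean1 r = (if r = 1 then 1 else (r - 1) / ln r)"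

text \<open>The power (1/e) r^(r/(r-1)) in exponential form, so that its logarithm can be read
  off.\<close>

definition identric1 :: "real \<Rightarrow> real" where
  "identric1 r = (if r = 1 then 1 else exp (r * ln r / (r - 1) - 1))"

lemma logmean1_pos: "r > 0 \<Longrightarrow> logmean1 r > 0"
  by (cases r "1::real" rule: linorder_cases) (auto simp: logmean1_def divide_neg_neg)

lemma identric1_pos: "identric1 r > 0"
  by (simp add: identric1_def)

lemma continuous_on_logmean1: "continuous_on {0<..} logmean1"
proof (rule continuous_at_imp_continuous_on, safe)
  fix r :: real assume "r > 0"
  show "isCont logmean1 r"
  proof (cases "r = 1")
    case True
    \<comment> \<open>The reciprocal of the mean is the difference quotient of \<open>ln\<close> at
      1.\<close>
    have "((\<lambda>y. (ln y - ln 1) / (y - 1)) \<longlongrightarrow> 1) (at (1::real))"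
      using DERIV_ln[of 1] by (simp add: has_field_derivative_iff)
    from tendsto_inverse[OF this] have "((\<lambda>y. (y - 1) / ln y) \<longlongrightarrow> 1) (at (1::real))" by simp
    moreover have "\<forall>\<^sub>F y in at (1::real). (y - 1) / ln y = logmean1 y"
      by (simp add: eventually_at_filter logmean1_def)
    ultimately show ?thesis
      by (simp add: True isCont_def logmean1_def[of 1] tendsto_cong)
  next
    case False
    have "\<forall>\<^sub>F y in nhds r. y \<noteq> 1" using t1_space_nhds[OF False] .
    then have "\<forall>\<^sub>F y in nhds r. logmean1 y = (y - 1) / ln y"
      by eventually_elim (simp add: logmean1_def)
    moreover have "isCont (\<lambda>y. (y - 1) / ln y) r"
      using \<open>r > 0\<close> False by (intro continuous_intros) auto
    ultimately show ?thesis by (simp add: isCont_cong)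
  qed
qed

lemma continuous_on_identric1: "continuous_on {0<..} identric1"
proof (rule continuous_at_imp_continuous_on, safe)
  fix r :: real assume "r > 0"
  show "isCont identric1 r"
  proof (cases "r = 1")
    case True
    \<comment> \<open>The exponent is, up to -1, the difference quotient of y ln y at 1.\<close>
    have "((\<lambda>y. y * ln y) has_real_derivative 1) (at 1)"
      by (auto intro!: derivative_eq_intros)
    then have "((\<lambda>y. y * ln y / (y - 1)) \<longlongrightarrow> 1) (at (1::real))"
      by (simp add: has_field_derivative_iff)
    then have "((\<lambda>y. exp (y * ln y / (y - 1) - 1)) \<longlongrightarrow> exp (1 - 1)) (at (1::real))"
      by (intro tendsto_intros)
    moreover have "\<forall>\<^sub>F y in at (1::real). exp (y * ln y / (y - 1) - 1) = identric1 y"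
      by (simp add: eventually_at_filter identric1_def)
    ultimately show ?thesis
      by (simp add: True isCont_def identric1_def[of 1] tendsto_cong)
  next
    case False
    have "\<forall>\<^sub>F y in nhds r. y \<noteq> 1" using t1_space_nhds[OF False] .
    then have "\<forall>\<^sub>F y in nhds r. identric1 y = exp (y * ln y / (y - 1) - 1)"
      by eventually_elim (simp add: identric1_def)
    moreover have "isCont (\<lambda>y. exp (y * ln y / (y - 1) - 1)) r"
      using \<open>r > 0\<close> False by (intro continuous_intros) auto
    ultimately show ?thesis by (simp add: isCont_cong)
  qed
qed

lemma segment_pos: "0 < 1 - t + t * r" if "r > 0" "t \<in> {0..1}" for t r :: real
proof (cases "t = 1")
  case False
  then show ?thesis using that by (intro add_pos_nonneg) auto
qed (use that in simp)

section \<open>Integral representations of the unweighted means\<close>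

lemma has_integral_logmean1:
  assumes "r > 0"
  shows "((\<lambda>t. r powr t) has_integral logmean1 r) {0..1}"
proof (cases "r = 1")
  case False
  have "((\<lambda>t. exp (t * ln r)) has_integral (exp (1 * ln r) / ln r - exp (0 * ln r) / ln r)) {0..1}"
  proof (rule fundamental_theorem_of_calculus)
    show "((\<lambda>t. exp (t * ln r) / ln r) has_vector_derivative exp (t * ln r)) (at t within {0..1})" for t
      unfolding has_real_derivative_iff_has_vector_derivative[symmetric]
      using assms False by (auto intro!: derivative_eq_intros)
  qed simp
  then show ?thesis using assms False by (simp add: powr_def logmean1_def diff_divide_distrib)
qed (use has_integral_const_real[of "1::real" 0 1] in \<open>simp add: logmean1_def\<close>)

lemma has_integral_inverse_logmean1:
  assumes "r > 0"
  shows "((\<lambda>t. 1 / (1 - t + t * r)) has_integral 1 / logmean1 r) {0..1}"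
proof (cases "r = 1")
  case False
  have "((\<lambda>t. 1 / (1 - t + t * r)) has_integral
      (ln (1 - 1 + 1 * r) / (r - 1) - ln (1 - 0 + 0 * r) / (r - 1))) {0..1}"
  proof (rule fundamental_theorem_of_calculus)
    show "((\<lambda>t. ln (1 - t + t * r) / (r - 1)) has_vector_derivative 1 / (1 - t + t * r)) (at t within {0..1})"
      if "t \<in> {0..1}" for t
      unfolding has_real_derivative_iff_has_vector_derivative[symmetric]
      using segment_pos[OF assms that] False by (auto intro!: derivative_eq_intros)
  qed simp
  then show ?thesis using False by (simp add: logmean1_def)
qed (use has_integral_const_real[of "1::real" 0 1] in \<open>simp add: logmean1_def\<close>)

lemma has_integral_ln_identric1:
  assumes "r > 0"
  shows "((\<lambda>t. ln (1 - t + t * r)) has_integral ln (identric1 r)) {0..1}"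
proof (cases "r = 1")
  case False
  define c where "c = r - 1"
  have c: "c \<noteq> 0" using False by (simp add: c_def)
  define u where "u t = 1 - t + t * r" for t
  \<comment> \<open>An antiderivative of ln u, since u is affine with slope c.\<close>
  define G where "G t = (u t * ln (u t) - u t) / c" for t
  have "((\<lambda>t. ln (1 - t + t * r)) has_integral (G 1 - G 0)) {0..1}"
  proof (rule fundamental_theorem_of_calculus)
    show "(G has_vector_derivative ln (1 - t + t * r)) (at t within {0..1})"
      if "t \<in> {0..1}" for t
    proof -
      have D: "(u has_real_derivative c) (at t within {0..1})"
        unfolding u_def c_def by (auto intro!: derivative_eq_intros)
      have "u t > 0" using segment_pos[OF assms that] by (simp add: u_def)
      then have "(G has_real_derivative ln (u t)) (at t within {0..1})"
        unfolding G_def using c by (auto intro!: derivative_eq_intros D simp: field_simps)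
      then show ?thesis by (simp add: has_real_derivative_iff_has_vector_derivative u_def)
    qed
  qed simp
  moreover have "G 1 - G 0 = ln (identric1 r)"
    using False by (simp add: G_def u_def c_def identric1_def field_simps)
  ultimately show ?thesis by simp
qed (simp add: identric1_def)

lemma has_integral_segment: "((\<lambda>t. 1 - t + t * r) has_integral (1 + r) / 2) {0..1}" for r :: real
proof -
  have "((\<lambda>t. 1 - t + t * r) has_integral ((1 - 1\<^sup>2 / 2 + 1\<^sup>2 / 2 * r) - (0 - 0\<^sup>2 / 2 + 0\<^sup>2 / 2 * r))) {0..1}"
    by (rule fundamental_theorem_of_calculus)
      (auto simp: has_real_derivative_iff_has_vector_derivative[symmetric] intro!: derivative_eq_intros)
  moreover have "(1 - 1\<^sup>2 / 2 + 1\<^sup>2 / 2 * r) - (0 - 0\<^sup>2 / 2 + 0\<^sup>2 / 2 * r) = (1 + r) / 2"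
    by (simp add: field_simps)
  ultimately show ?thesis by (simp only:)
qed

text \<open>Write y for a point of the segment. The tangent bound ln(w/y) \<le> w/y - 1 is used with
  w = L(1,r), because then w/y has integral 1 and the linear terms cancel.\<close>

lemma logmean1_le_identric1:
  assumes "r > 0"
  shows "logmean1 r \<le> identric1 r"
proof -
  define w where "w = logmean1 r"
  have w: "w > 0" using logmean1_pos assms by (simp add: w_def)
  have "((\<lambda>t. ln w + 1 - w * (1 / (1 - t + t * r))) has_integral ((ln w + 1) - w * (1 / w))) {0..1}"
    using has_integral_diff[OF has_integral_const_real[of "ln w + 1" 0 1]
        has_integral_mult_right[OF has_integral_inverse_logmean1[OF assms], of w]]
    by (simp add: w_def)
  then have "(ln w + 1) - w * (1 / w) \<le> ln (identric1 r)"
  proof (rule has_integral_le[OF _ has_integral_ln_identric1[OF assms]])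
    fix t :: real assume t: "t \<in> {0..1}"
    let ?y = "1 - t + t * r"
    have y: "?y > 0" by (rule segment_pos[OF assms t])
    have "ln (w / ?y) \<le> w / ?y - 1" using w y by (intro ln_le_minus_one) simp
    then show "ln w + 1 - w * (1 / ?y) \<le> ln ?y" using w y by (simp add: ln_div)
  qed
  then have "ln w \<le> ln (identric1 r)" using w by simp
  then show ?thesis using w identric1_pos by (simp add: w_def)
qed

text \<open>Tangent line of ln at the average c of the segment: y/c has integral 1, so only ln c
  remains.\<close>

lemma identric1_le_amean:
  assumes "r > 0"
  shows "identric1 r \<le> (1 + r) / 2"
proof -
  define c where "c = (1 + r) / 2"
  have c: "c > 0" using assms by (simp add: c_def)
  have "((\<lambda>t. ln c - 1 + 1 / c * (1 - t + t * r)) has_integral ((ln c - 1) + 1 / c * c)) {0..1}"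
    using has_integral_add[OF has_integral_const_real[of "ln c - 1" 0 1]
        has_integral_mult_right[OF has_integral_segment[of r], of "1 / c"]]
    by (simp add: c_def)
  then have "ln (identric1 r) \<le> (ln c - 1) + 1 / c * c"
  proof (rule has_integral_le[OF has_integral_ln_identric1[OF assms]])
    fix t :: real assume t: "t \<in> {0..1}"
    let ?y = "1 - t + t * r"
    have y: "?y > 0" by (rule segment_pos[OF assms t])
    have "ln (?y / c) \<le> ?y / c - 1" using c y by (intro ln_le_minus_one) simp
    then show "ln ?y \<le> ln c - 1 + 1 / c * ?y" using c y by (simp add: ln_div)
  qed
  then have "ln (identric1 r) \<le> ln c" using c by simp
  then show ?thesis using c identric1_pos by (simp add: c_def)
qed

lemma young_one: "u powr t \<le> 1 - t + t * u" if "u > 0" "0 \<le> t" "t \<le> 1" for u t :: real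
  using Youngs_inequality_0[of "1 - t" t 1 u] that by simp

text \<open>Weighted arithmetic-geometric inequality in logarithmic form, t ln r \<le> ln(1 - t + t
  r), integrated over t; the left side has integral (ln r)/2.\<close>

lemma sqrt_le_identric1:
  assumes "r > 0"
  shows "sqrt r \<le> identric1 r"
proof -
  have "((\<lambda>t. t * ln r) has_integral (1\<^sup>2 / 2 * ln r - 0\<^sup>2 / 2 * ln r)) {0..1}"
    by (rule fundamental_theorem_of_calculus)
      (auto simp: has_real_derivative_iff_has_vector_derivative[symmetric] intro!: derivative_eq_intros)
  then have "1\<^sup>2 / 2 * ln r - 0\<^sup>2 / 2 * ln r \<le> ln (identric1 r)"
  proof (rule has_integral_le[OF _ has_integral_ln_identric1[OF assms]])
    fix t :: real assume t: "t \<in> {0..1}"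
    have "ln (r powr t) \<le> ln (1 - t + t * r)"
      using young_one[of r t] t assms segment_pos[OF assms t] by (subst ln_le_cancel_iff) auto
    then show "t * ln r \<le> ln (1 - t + t * r)" using assms by (simp add: ln_powr)
  qed
  then have "ln (sqrt r) \<le> ln (identric1 r)" using assms by (simp add: ln_sqrt)
  then show ?thesis using assms identric1_pos by simp
qed

lemma wamean_pos: "(1 - v) * a + v * b > 0" if "a > 0" "b > 0" "0 \<le> v" "v \<le> 1" for a b v :: real
  using that by (cases "v = 1") (auto intro!: add_pos_nonneg)

text \<open>Each u^t lies below the tangent line c^t (1 - t + t u/c) at the weighted mean c;
  averaging replaces u/c by 1.\<close>

lemma powr_concave:
  fixes a b t v :: real
  assumes "a > 0" "b > 0" "0 \<le> t" "t \<le> 1" "0 \<le> v" "v \<le> 1"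
  shows "(1 - v) * a powr t + v * b powr t \<le> ((1 - v) * a + v * b) powr t"
proof -
  define c where "c = (1 - v) * a + v * b"
  have c: "c > 0"
    unfolding c_def by (intro wamean_pos assms)
  have le: "u powr t \<le> c powr t * (1 - t + t * (u / c))" if "u > 0" for u
    using young_one[of "u / c" t] that c assms by (simp add: powr_divide field_simps)
  have "(1 - v) * a powr t + v * b powr t
      \<le> (1 - v) * (c powr t * (1 - t + t * (a / c))) + v * (c powr t * (1 - t + t * (b / c)))"
    using assms by (intro add_mono mult_left_mono le) auto
  also have "\<dots> = c powr t * (1 - t + t * (((1 - v) * a + v * b) / c))"
    using c by (simp add: field_simps)
  also have "\<dots> = c powr t" using c by (simp add: c_def[symmetric])
  finally show ?thesis by (simp add: c_def)
qed

lemma logmean1_concave: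
  assumes "a > 0" "b > 0" "0 \<le> v" "v \<le> 1"
  shows "(1 - v) * logmean1 a + v * logmean1 b \<le> logmean1 ((1 - v) * a + v * b)"
proof (rule has_integral_le)
  have c: "(1 - v) * a + v * b > 0"
    by (intro wamean_pos assms)
  show "((\<lambda>t. (1 - v) * a powr t + v * b powr t) has_integral
      (1 - v) * logmean1 a + v * logmean1 b) {0..1}"
    by (intro has_integral_add has_integral_mult_right has_integral_logmean1 assms)
  show "((\<lambda>t. ((1 - v) * a + v * b) powr t) has_integral logmean1 ((1 - v) * a + v * b)) {0..1}"
    by (rule has_integral_logmean1[OF c])
qed (use assms in \<open>auto intro: powr_concave\<close>)

text \<open>Symmetry of L combined with homogeneity: r L(1,1/r) = L(r,1).\<close>

lemma logmean1_inverse: "r * logmean1 (1 / r) = logmean1 r" if "r > 0"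
  using that by (auto simp: logmean1_def ln_div field_simps)

section \<open>Weighted means expressed by unweighted ones\<close>

lemma wlogmean_half: "wlogmean (1/2) 1 x = logmean1 x" if "x > 0"
  using that by (simp add: wlogmean_def logmean1_def field_simps)

text \<open>The power of the arithmetic mean disappears, as its exponent contains the factor 1 -
  2v.\<close>

lemma widentric_half: "widentric (1/2) 1 x = identric1 x" if "x > 0"
proof -
  have "(x powr x) powr (1 / (x - 1)) = exp (x * ln x / (x - 1))"
    using that by (simp add: powr_def)
  then show ?thesis using that by (simp add: widentric_def identric1_def wamean_def exp_diff)
qed

text \<open>For 0 < v < 1 the two unweighted means are the averages of x^t over t in [0,v] and
  [v,1]; their weights 1 - v and v are swapped relative to the interval lengths. The right-hand side
  has no singular cases in v or x.\<close>

lemma wlogmean_eq: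
  assumes "x > 0" "0 \<le> v" "v \<le> 1"
  shows "wlogmean v 1 x = (1 - v) * logmean1 (x powr v) + v * (x powr v * logmean1 (x powr (1 - v)))"
proof (cases "v = 0 \<or> v = 1 \<or> x = 1")
  case True
  then show ?thesis using assms by (auto simp: wlogmean_def logmean1_def)
next
  case False
  define g l where "g = x powr v" and "l = ln x"
  have v: "v \<noteq> 0" "v \<noteq> 1" "x \<noteq> 1" and l: "l \<noteq> 0" and g: "g > 0"
    using False assms by (auto simp: g_def l_def)
  have ln: "ln (x powr v) = v * l" "ln (x powr (1 - v)) = (1 - v) * l"
    using assms by (simp_all add: ln_powr l_def)
  have ne: "x powr v \<noteq> 1" "x powr (1 - v) \<noteq> 1"
    using ln v l by (metis ln_one mult_eq_0_iff right_minus_eq)+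
  have xg: "x powr (1 - v) = x / g" using assms by (simp add: g_def powr_diff)
  have "wlogmean v 1 x = 1 / (- l) * ((1 - v) / v * (1 - g) + v / (1 - v) * (g - x))"
    using v by (simp add: wlogmean_def g_def l_def)
  also have "\<dots> = (1 - v) * ((g - 1) / (v * l)) + v * (g * ((x / g - 1) / ((1 - v) * l)))"
    using v l g by (simp add: divide_simps) (simp add: algebra_simps)
  finally have "wlogmean v 1 x = \<dots>" .
  moreover have "logmean1 (x powr v) = (x powr v - 1) / (v * l)"
    "logmean1 (x powr (1 - v)) = (x powr (1 - v) - 1) / ((1 - v) * l)"
    using ne ln by (simp_all add: logmean1_def)
  ultimately show ?thesis by (simp only: xg g_def[symmetric])
qed

text \<open>Factoring out g = x^v gives both terms the same first argument, as L(1,g) = g L(1,1/g)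
  and L(g,x) = g L(1,x/g). Concavity in one variable then suffices.\<close>

lemma wlogmean_le:
  assumes "x > 0" "0 \<le> v" "v \<le> 1"
  shows "wlogmean v 1 x \<le> x powr v * logmean1 (((1 - v) + v * x) / x powr v)"
proof -
  define g where "g = x powr v"
  have g: "g > 0" using assms by (simp add: g_def)
  have "wlogmean v 1 x = (1 - v) * logmean1 g + v * (g * logmean1 (x / g))"
    using wlogmean_eq[OF assms] assms by (simp add: g_def powr_diff)
  also have "\<dots> = (1 - v) * (g * logmean1 (1 / g)) + v * (g * logmean1 (x / g))"
    by (simp only: logmean1_inverse[OF g])
  also have "\<dots> = g * ((1 - v) * logmean1 (1 / g) + v * logmean1 (x / g))"
    by (simp add: algebra_simps)
  also have "\<dots> \<le> g * logmean1 ((1 - v) * (1 / g) + v * (x / g))"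
    using g assms by (intro mult_left_mono logmean1_concave) auto
  also have "(1 - v) * (1 / g) + v * (x / g) = ((1 - v) + v * x) / g"
    by (simp add: add_divide_distrib)
  finally show ?thesis by (simp add: g_def)
qed

text \<open>The logarithm of the right-hand side is (1 - v) times the average of ln on the segment
  from 1 to m plus v times its average on the segment from m to x. The two sides are compared after
  taking logarithms, where both are affine in ln m and ln x.\<close>

lemma widentric_eq:
  assumes "x > 0" "0 \<le> v" "v \<le> 1"
  shows "widentric v 1 x = identric1 ((1 - v) + v * x) powr (1 - v)
    * (((1 - v) + v * x) * identric1 (x / ((1 - v) + v * x))) powr v"
proof (cases "v = 0 \<or> v = 1 \<or> x = 1")
  case True
  then show ?thesis using assms by (auto simp: widentric_def identric1_def)
next
  case False
  define m where "m = (1 - v) + v * x"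
  have v: "v > 0" "v < 1" "x \<noteq> 1" using False assms by auto
  have m: "m > 0" using wamean_pos[of 1 x v] assms by (simp add: m_def)
  have d: "m - 1 = v * (x - 1)" "x - m = (1 - v) * (x - 1)" by (simp_all add: m_def algebra_simps)
  then have ne: "m \<noteq> 1" "x / m \<noteq> 1" using v m by auto
  define p q where "p = ln m" and "q = ln x"
  have I1: "ln (identric1 m) = m * p / (v * (x - 1)) - 1"
    using ne d(1) by (simp add: identric1_def p_def)
  have "ln (identric1 (x / m)) = (x / m) * (q - p) / (x / m - 1) - 1"
    using ne assms m by (simp add: identric1_def p_def q_def ln_div)
  also have "(x / m) * (q - p) / (x / m - 1) = x * (q - p) / (x - m)"
    using m ne by (simp add: field_simps)
  finally have I2: "ln (identric1 (x / m)) = x * (q - p) / ((1 - v) * (x - 1)) - 1"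
    by (simp only: d(2))
  have "ln (widentric v 1 x) = (1 - 2 * v) * m / (v * (1 - v) * (x - 1)) * p - 1
      + 1 / (x - 1) * (v * x / (1 - v) * q)"
    using v m assms by (simp add: widentric_def wamean_def m_def[symmetric] ln_mult ln_div ln_powr p_def q_def)
  also have "\<dots> = (1 - v) * (m * p / (v * (x - 1)) - 1)
      + v * (p + (x * (q - p) / ((1 - v) * (x - 1)) - 1))"
    using v by (simp add: m_def divide_simps) (simp add: algebra_simps)
  also have "\<dots> = ln (identric1 m powr (1 - v) * (m * identric1 (x / m)) powr v)"
    using m identric1_pos[of m] identric1_pos[of "x / m"]
    by (simp add: ln_mult ln_powr I1 I2 p_def[symmetric])
  finally have "ln (widentric v 1 x) = ln (identric1 m powr (1 - v) * (m * identric1 (x / m)) powr v)" .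
  moreover have "widentric v 1 x > 0"
    using v m assms by (simp add: widentric_def wamean_def m_def[symmetric])
  moreover have "identric1 m powr (1 - v) * (m * identric1 (x / m)) powr v > 0"
    using m identric1_pos[of m] identric1_pos[of "x / m"] by simp
  ultimately show ?thesis by (simp add: m_def)
qed

text \<open>In x^v = y^v y^v with y = sqrt x, the weighted arithmetic-geometric inequality is
  applied to one factor only.\<close>

lemma gmean_le_refined:
  assumes "x > 0" "0 \<le> v" "v \<le> 1"
  shows "x powr v \<le> ((1 - v) + v * sqrt x) * sqrt x powr v"
proof -
  have "x powr v = sqrt x powr v * sqrt x powr v"
    using assms by (simp add: powr_mult[symmetric])
  also have "\<dots> \<le> ((1 - v) + v * sqrt x) * sqrt x powr v"
    using young_one[of "sqrt x" v] assms by (intro mult_right_mono) auto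
  finally show ?thesis .
qed

lemma refined_le_widentric:
  assumes "x > 0" "0 \<le> v" "v \<le> 1"
  shows "((1 - v) + v * sqrt x) * sqrt x powr v \<le> widentric v 1 x"
proof -
  define m where "m = (1 - v) + v * x"
  have m: "m > 0" using wamean_pos[of 1 x v] assms by (simp add: m_def)
  \<comment> \<open>The subtracted term is the variance of 1 and sqrt x with weights 1 - v and
    v.\<close>
  have "((1 - v) + v * sqrt x)\<^sup>2 = m - v * (1 - v) * (1 - sqrt x)\<^sup>2"
    using assms by (simp add: m_def power2_eq_square algebra_simps)
  also have "\<dots> \<le> m" using assms by simp
  finally have "(1 - v) + v * sqrt x \<le> sqrt m" by (rule real_le_rsqrt)
  then have "((1 - v) + v * sqrt x) * sqrt x powr v \<le> sqrt m * sqrt x powr v"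
    by (intro mult_right_mono) auto
  \<comment> \<open>Rewritten in the shape of \<open>widentric_eq\<close>, with each identric mean
    replaced by the smaller geometric one.\<close>
  also have "\<dots> = sqrt m powr (1 - v) * (m * sqrt (x / m)) powr v"
  proof -
    have "m * sqrt (x / m) = sqrt m * sqrt x"
      using m by (simp add: real_sqrt_divide field_simps)
    moreover have "sqrt m powr (1 - v) * sqrt m powr v = sqrt m"
      using m by (simp add: powr_add[symmetric])
    ultimately show ?thesis using m assms by (simp add: powr_mult mult.assoc[symmetric])
  qed
  also have "\<dots> \<le> identric1 m powr (1 - v) * (m * identric1 (x / m)) powr v"
    using m assms by (intro mult_mono powr_mono2 mult_left_mono sqrt_le_identric1) auto
  also have "\<dots> = widentric v 1 x" using widentric_eq[OF assms] by (simp add: m_def)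
  finally show ?thesis .
qed

text \<open>The decomposition replaces the case distinction at x = 1 by the continuity of
  \<open>logmean1\<close>.\<close>

lemma continuous_on_wlogmean:
  assumes "0 \<le> v" "v \<le> 1"
  shows "continuous_on {0<..} (wlogmean v 1)"
proof -
  have "continuous_on {0<..} (\<lambda>x. (1 - v) * logmean1 (x powr v) + v * (x powr v * logmean1 (x powr (1 - v))))"
    by (intro continuous_intros continuous_on_compose2[OF continuous_on_logmean1]) auto
  then show ?thesis
    by (rule continuous_on_eq) (use assms in \<open>simp add: wlogmean_eq\<close>)
qed

lemma continuous_on_widentric:
  assumes "0 \<le> v" "v \<le> 1"
  shows "continuous_on {0<..} (widentric v 1)"
proof -
  have m: "(1 - v) + v * x > 0" if "x > 0" for x using wamean_pos[of 1 x v] assms that by simp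
  have "continuous_on {0<..} (\<lambda>x. identric1 ((1 - v) + v * x) powr (1 - v)
    * (((1 - v) + v * x) * identric1 (x / ((1 - v) + v * x))) powr v)"
    by (intro continuous_intros continuous_on_compose2[OF continuous_on_identric1])
      (use m identric1_pos in \<open>auto simp: less_imp_neq[symmetric]\<close>)
  then show ?thesis
    by (rule continuous_on_eq) (use assms in \<open>simp add: widentric_eq\<close>)
qed

section \<open>Inequalities between operator means\<close>

text \<open>The factor \<open>id_blinfun\<close> is kept so that A and B appear as the same
  congruence, of 1 and of T.\<close>

lemma simultaneous_congruence:
  fixes A B :: "'a::chilbert \<Rightarrow>\<^sub>L 'a"
  assumes A: "A \<in> positive_invertible_ops" and B: "B \<in> positive_invertible_ops"
  obtains C T where "C \<in> positive_invertible_ops" "T \<in> positive_invertible_ops"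
    "A = C o\<^sub>L id_blinfun o\<^sub>L C" "B = C o\<^sub>L T o\<^sub>L C"
proof
  define C D where "C = op_powr A (1/2)" and "D = op_powr A (-1/2)"
  have CD: "C o\<^sub>L C = A" "C o\<^sub>L D = id_blinfun" "D o\<^sub>L C = id_blinfun"
    by (simp_all add: C_def D_def op_powr_compose A op_powr_0 op_powr_1)
  show "C \<in> positive_invertible_ops" "D o\<^sub>L B o\<^sub>L D \<in> positive_invertible_ops"
    by (simp_all add: C_def D_def op_powr_positive_invertible positive_invertible_sandwich A B)
  show "A = C o\<^sub>L id_blinfun o\<^sub>L C" by (simp add: CD)
  have "C o\<^sub>L (D o\<^sub>L B o\<^sub>L D) o\<^sub>L C = (C o\<^sub>L D) o\<^sub>L B o\<^sub>L (D o\<^sub>L C)"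
    by (simp only: compose_assoc)
  then show "B = C o\<^sub>L (D o\<^sub>L B o\<^sub>L D) o\<^sub>L C" by (simp add: CD)
qed

theorem theorem4p4:
  fixes A B :: "'a::chilbert \<Rightarrow>\<^sub>L 'a" and v :: real
  assumes "A \<in> positive_invertible_ops" and "B \<in> positive_invertible_ops"
    and "0 \<le> v" and "v \<le> 1"
  shows "op_logmean v A B \<preceq> op_logmean (1/2) (op_gmean v A B) (op_amean v A B) \<and>
    op_logmean (1/2) (op_gmean v A B) (op_amean v A B)
      \<preceq> op_identric (1/2) (op_gmean v A B) (op_amean v A B) \<and>
    op_identric (1/2) (op_gmean v A B) (op_amean v A B)
      \<preceq> op_amean (1/2) (op_gmean v A B) (op_amean v A B) \<and>
    op_gmean v A B
      \<preceq> op_gmean v (op_amean v A (op_gmean (1/2) A B)) (op_amean v (op_gmean (1/2) A B) B) \<and>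
    op_gmean v (op_amean v A (op_gmean (1/2) A B)) (op_amean v (op_gmean (1/2) A B) B)
      \<preceq> op_identric v A B"
proof -
  obtain C T where C: "C \<in> positive_invertible_ops" and T: "T \<in> positive_invertible_ops"
    and AB: "A = C o\<^sub>L id_blinfun o\<^sub>L C" "B = C o\<^sub>L T o\<^sub>L C"
    by (rule simultaneous_congruence[OF assms(1,2)])
  define K where "K f = C o\<^sub>L cfc f T o\<^sub>L C" for f
  \<comment> \<open>The conditions under which f(T) is positive and invertible, and thus a
    legitimate argument of a mean.\<close>
  define cpos where "cpos f \<longleftrightarrow> continuous_on {0<..} f \<and> (\<forall>x>0. f x > 0)" for f :: "real \<Rightarrow> real"
  have A: "A = K (\<lambda>x. 1)" and B: "B = K (\<lambda>x. x)"
    by (simp_all add: K_def AB cfc_const[OF T] cfc_ident[OF T])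
  have cong: "K f = K g" if "continuous_on {0<..} g" "\<And>x. x > 0 \<Longrightarrow> f x = g x" for f g
    unfolding K_def using cfc_cong[OF T that] by simp
  have mono: "K f \<preceq> K g"
    if "continuous_on {0<..} f" "continuous_on {0<..} g" "\<And>x. x > 0 \<Longrightarrow> f x \<le> g x" for f g
    unfolding K_def by (intro loewner_le_sandwich cfc_mono positive_invertible_opsD(3) C T that)
  \<comment> \<open>The congruence by \<open>C\<close> is pulled out of the mean; what remains is a
    mean of two functions of \<open>T\<close>.\<close>
  have mean: "op_mean F (K f) (K g) = K (\<lambda>x. f x * F (g x / f x))"
    if "continuous_on {0<..} F" "cpos f" "cpos g" for F f g
    using that unfolding K_def cpos_def
    by (subst op_mean_congruence) (auto intro!: positive_invertible_cfc C T simp: op_mean_cfc[OF T])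
  have amean: "op_amean p (K f) (K g) = K (\<lambda>x. (1 - p) * f x + p * g x)" if "cpos f" "cpos g" for p f g
    using that unfolding K_def cpos_def op_amean_def
    by (simp add: cfc_add[OF T] cfc_scaleR[OF T] continuous_on_mult_left compose_distribs)
  have powr: "continuous_on {0<..} (\<lambda>x::real. x powr p)" for p by (intro continuous_intros) auto
  have cpos_basic: "cpos (\<lambda>x. 1)" "cpos (\<lambda>x. x)" "cpos (\<lambda>x. x powr v)" "cpos sqrt"
    using powr by (auto simp: cpos_def intro!: continuous_intros)
  have cpos_amean: "cpos (\<lambda>x. (1 - v) * f x + v * g x)" if "cpos f" "cpos g" for f g
    using that wamean_pos assms(3,4) by (auto simp: cpos_def intro!: continuous_intros)
  have cpos_div: "continuous_on {0<..} (\<lambda>x. g x / f x)" "\<And>x. x > 0 \<Longrightarrow> g x / f x > 0"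
    if "cpos f" "cpos g" for f g
    using that by (auto simp: cpos_def intro!: continuous_intros simp: less_imp_neq[symmetric])

  define g m where "g x = x powr v" and "m x = (1 - v) + v * x" for x :: real
  have g: "cpos g" and m: "cpos m"
    using cpos_basic(3) cpos_amean[OF cpos_basic(1,2)] by (simp_all add: g_def[abs_def] m_def[abs_def])
  have gm: "op_gmean v A B = K g" and gm2: "op_gmean (1/2) A B = K sqrt"
    unfolding op_gmean_def A B mean[OF powr cpos_basic(1,2)]
    by (rule cong; simp add: g_def[abs_def] powr powr_half_sqrt continuous_intros)+
  have am: "op_amean v A B = K m"
    unfolding A B amean[OF cpos_basic(1,2)] by (simp add: m_def[abs_def])
  have L: "op_logmean v A B = K (wlogmean v 1)" and I: "op_identric v A B = K (widentric v 1)"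
    unfolding op_logmean_def op_identric_def A B
    by (subst mean; simp add: cpos_basic continuous_on_wlogmean continuous_on_widentric assms)+
  \<comment> \<open>The scalar means L(g,m) and I(g,m), written by homogeneity through their
    one-variable forms.\<close>
  define Lc Ic where "Lc x = g x * logmean1 (m x / g x)" and "Ic x = g x * identric1 (m x / g x)" for x
  have gpos: "g x > 0" "m x / g x > 0" if "x > 0" for x
    using that g cpos_div(2)[OF g m] by (auto simp: cpos_def)
  have cLc: "continuous_on {0<..} Lc" and cIc: "continuous_on {0<..} Ic"
    unfolding Lc_def Ic_def using g cpos_div[OF g m]
    by (auto simp: cpos_def intro!: continuous_intros continuous_on_compose2[OF continuous_on_logmean1]
        continuous_on_compose2[OF continuous_on_identric1])
  have Lc: "op_logmean (1/2) (K g) (K m) = K Lc"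
    unfolding op_logmean_def
    by (subst mean[OF _ g m]) (auto intro!: cong cLc continuous_on_wlogmean simp: Lc_def gpos wlogmean_half)
  have Ic: "op_identric (1/2) (K g) (K m) = K Ic"
    unfolding op_identric_def
    by (subst mean[OF _ g m]) (auto intro!: cong cIc continuous_on_widentric simp: Ic_def gpos widentric_half)
  define R where "R x = ((1 - v) + v * sqrt x) * sqrt x powr v" for x
  have cR: "continuous_on {0<..} R"
    unfolding R_def by (intro continuous_intros) auto
  have R: "op_gmean v (op_amean v A (op_gmean (1/2) A B)) (op_amean v (op_gmean (1/2) A B) B) = K R"
  proof -
    let ?f = "\<lambda>x. (1 - v) * 1 + v * sqrt x" and ?h = "\<lambda>x. (1 - v) * sqrt x + v * x"
    have f: "cpos ?f" and h: "cpos ?h" by (intro cpos_amean cpos_basic)+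
    have "op_gmean v (K ?f) (K ?h) = K (\<lambda>x. ?f x * (?h x / ?f x) powr v)"
      unfolding op_gmean_def by (rule mean[OF powr f h])
    also have "\<dots> = K R"
    proof (rule cong[OF cR])
      fix x :: real assume x: "x > 0"
      \<comment> \<open>The two arithmetic means have ratio exactly sqrt x, which makes their
        weighted geometric mean explicit.\<close>
      have "?h x = sqrt x * ?f x" using x by (simp add: algebra_simps)
      moreover have "?f x > 0" using f x by (simp add: cpos_def)
      ultimately have "?h x / ?f x = sqrt x" by simp
      then show "?f x * (?h x / ?f x) powr v = R x" by (simp add: R_def)
    qed
    finally show ?thesis
      \<comment> \<open>\<open>gm2\<close> is applied separately beforehand, since rewriting
        \<open>A\<close> and \<open>B\<close> would destroy its left-hand side.\<close>
      unfolding gm2 unfolding A B amean[OF cpos_basic(1,4)] amean[OF cpos_basic(4,2)] .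
  qed
  have "K (wlogmean v 1) \<preceq> K Lc"
    by (rule mono[OF continuous_on_wlogmean cLc])
      (use wlogmean_le assms in \<open>auto simp: Lc_def g_def m_def\<close>)
  moreover have "K Lc \<preceq> K Ic"
    by (rule mono[OF cLc cIc]) (simp add: Lc_def Ic_def gpos logmean1_le_identric1 mult_left_mono less_imp_le)
  moreover have "K Ic \<preceq> op_amean (1/2) (K g) (K m)"
    unfolding amean[OF g m]
  proof (rule mono[OF cIc])
    show "continuous_on {0<..} (\<lambda>x. (1 - 1/2) * g x + 1/2 * m x)"
      using g m by (auto simp: cpos_def intro!: continuous_intros)
    fix x :: real assume x: "x > 0"
    have "Ic x \<le> g x * ((1 + m x / g x) / 2)"
      unfolding Ic_def using gpos[OF x] by (intro mult_left_mono identric1_le_amean) auto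
    also have "\<dots> = (1 - 1/2) * g x + 1/2 * m x" using gpos(1)[OF x] by (simp add: field_simps)
    finally show "Ic x \<le> (1 - 1/2) * g x + 1/2 * m x" .
  qed
  moreover have "K g \<preceq> K R"
    by (rule mono[OF _ cR])
      (use g gmean_le_refined assms in \<open>auto simp: cpos_def g_def R_def\<close>)
  moreover have "K R \<preceq> K (widentric v 1)"
    by (rule mono[OF cR continuous_on_widentric])
      (use refined_le_widentric assms in \<open>auto simp: R_def\<close>)
  ultimately show ?thesis unfolding R unfolding L I gm am Lc Ic by blast
qed

end
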